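(* Fix $T>0$, an acceleration factor $\delta\in(0,1]$, delays $0\le\tau_1\le\tau_2\le T$, and noise level $\sigma_0^2>0$, and let $P_1,P_2>0$. Let $g(t)=\int_{-\infty}^{\infty}p(s)p^*(s-t)\,ds$ be the autocorrelation of the transmit pulse $p$, and define, for $\lambda\in[-\tfrac12,\tfrac12]$, $$G_\delta(\lambda)=\sum_{n=-\infty}^{\infty} g(n\delta T)e^{j2\pi\lambda n},\qquad G_{12,\delta}(\lambda)=\sum_{n=-\infty}^{\infty} g\big(n\delta T+(\tau_1-\tau_2)\big)e^{j2\pi\lambda n}.$$ For data power spectra $S_{a1},S_{a2}$ (real, nonnegative, even functions on $[-\tfrac12,\tfrac12]$ with absolutely summable Fourier coefficients $r_k[n]=\int_{-1/2}^{1/2}S_{ak}(\lambda)e^{j2\pi\lambda n}d\lambda$), let $\bm{R}_{k,N}$ be the $N\times N$ Toeplitz matrix with entries $(\bm{R}_{k,N})_{n,m}=r_k[n-m]$, let $\bm{G}_N$ be the $N\times N$ matrix with entries $g((n-m)\delta T)$, $\bm{G}_{12,N}$ the $N\times N$ matrix with entries $g((n-m)\delta T+(\tau_1-\tau_2))$, $\bm{G}_{21,N}=\bm{G}_{12,N}^\dagger$, and $$\tilde{\bm{G}}_N=\begin{bmatrix}\bm{G}_N&\bm{G}_{12,N}\\ \bm{G}_{21,N}&\bm{G}_N\end{bmatrix},\qquad \tilde{\bm{R}}_N=\begin{bmatrix}\bm{R}_{1,N}&\bm{0}\\ \bm{0}&\bm{R}_{2,N}\end{bmatrix}.$$ Define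 the capacity region $$C=\bigcup\Big\{(R_1,R_2):\ 0\le R_1\le \lim_{N\to\infty}\tfrac{1}{2N}\log_2\det(\bm{I}_N+\sigma_0^{-2}\bm{G}_N\bm{R}_{1,N}),\ 0\le R_2\le \lim_{N\to\infty}\tfrac{1}{2N}\log_2\det(\bm{I}_N+\sigma_0^{-2}\bm{G}_N\bm{R}_{2,N}),\ 0\le R_1+R_2\le \lim_{N\to\infty}\tfrac{1}{2N}\log_2\det(\bm{I}_{2N}+\sigma_0^{-2}\tilde{\bm{G}}_N\tilde{\bm{R}}_N)\Big\},$$ the union being over all admissible pairs $(S_{a1},S_{a2})$ satisfying the power constraints $\frac{1}{\delta T}\int_{-1/2}^{1/2}G_\delta(\lambda)S_{ak}(\lambda)\,d\lambda\le P_k$, $k=1,2$. Then, writing $S_k(\lambda)=G_\delta(\lambda)S_{ak}(\lambda)$, $$C=\bigcup\Big\{(R_1,R_2):\ R_1\le \tfrac12\int_{-1/2}^{1/2}\log_2\big(1+\sigma_0^{-2}S_1(\lambda)\big)d\lambda,\ R_2\le \tfrac12\int_{-1/2}^{1/2}\log_2\big(1+\sigma_0^{-2}S_2(\lambda)\big)d\lambda,$$ $$R_1+R_2\le \tfrac12\int_{-1/2}^{1/2}\log_2\Big(1+\sigma_0^{-2}S_1(\lambda)+\sigma_0^{-2}S_2(\lambda)+\sigma_0^{-4}S_1(\lambda)S_2(\lambda)\Big[1-\Big|\tfrac{G_{12,\delta}(\lambda)}{G_\delta(\lambda)}\Big|^2\Big]\Big)d\lambda\Big\},$$ the union again over the same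 admissible pairs $(S_{a1},S_{a2})$ (all three limits defining $C$ exist and equal the corresponding integrals).
   Context: Setting: two-user asynchronous multiple access channel with faster-than-Nyquist (FTN) signaling. User $k$ transmits $x_k(t)=\sum_{m=0}^{N-1}a_k[m]p(t-m\delta T-\tau_k)$; the receiver adds white Gaussian noise of spectral density $\sigma_0^2$, applies the matched filter $p^*(-t)$ and samples at $n\delta T+\tau_k$, $n=0,\dots,N-1$, $k=1,2$, giving $\bm{y}=\tilde{\bm{G}}_N\bm{a}+\bm{\eta}$ with noise covariance $\sigma_0^2\tilde{\bm{G}}_N$. Inputs of the two users are independent stationary Gaussian processes with autocorrelations $r_k[n]=\mathbb{E}[a_k[m+n]a_k^*[m]]$ and data spectra $S_{ak}(\lambda)=\sum_n r_k[n]e^{-j2\pi\lambda n}$; the log-det expressions in the claim are the normalized mutual informations $I(\bm a_1;\bm y\mid\bm a_2)$, $I(\bm a_2;\bm y\mid\bm a_1)$, $I(\bm a_1,\bm a_2;\bm y)$ for such inputs. The pulse autocorrelation $g$ is assumed such that the sequences $g(n\delta T)$ and $g(n\delta T+s)$ are absolutely summable (e.g. $p$ a root raised cosine pulse, so $g$ is a raised cosine pulse).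
   Formalization: The integral-form region is taken with R_1 ≥ 0 and R_2 ≥ 0, as in the definition of C; without this the equality fails (e.g. (-1,-1) lies only in the right-hand set). Where G_δ(λ)=0 the quotient G_{12,δ}/G_δ is read as 0. *)

theory Defs
  imports "HOL-Analysis.Analysis" "Jordan_Normal_Form.Schur_Decomposition"
begin

definition autocorr :: "(real \<Rightarrow> complex) \<Rightarrow> real \<Rightarrow> complex" where
  "autocorr p t = integral UNIV (\<lambda>s. p s * cnj (p (s - t)))"

text \<open>Folded spectra G_delta(lambda) (shift 0) and G_{12,delta}(lambda) (shift tau1 - tau2).\<close>
definition folded_spec :: "(real \<Rightarrow> complex) \<Rightarrow> real \<Rightarrow> real \<Rightarrow> real \<Rightarrow> real \<Rightarrow> complex" where
  "folded_spec g \<delta> T s lam =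
     infsum (\<lambda>n::int. g (real_of_int n * \<delta> * T + s) * exp (\<i> * complex_of_real (2 * pi * lam * real_of_int n))) UNIV"

definition fcoef :: "(real \<Rightarrow> real) \<Rightarrow> int \<Rightarrow> complex" where
  "fcoef S n = integral {-1/2..1/2} (\<lambda>lam. complex_of_real (S lam) * exp (\<i> * complex_of_real (2 * pi * lam * real_of_int n)))"

definition Gmat :: "(real \<Rightarrow> complex) \<Rightarrow> real \<Rightarrow> real \<Rightarrow> real \<Rightarrow> nat \<Rightarrow> complex Matrix.mat" where
  "Gmat g \<delta> T s N = Matrix.mat N N (\<lambda>(n, m). g ((real n - real m) * \<delta> * T + s))"

definition Rmat :: "(real \<Rightarrow> real) \<Rightarrow> nat \<Rightarrow> complex Matrix.mat" where
  "Rmat S N = Matrix.mat N N (\<lambda>(n, m). fcoef S (int n - int m))"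

definition Gtilde :: "(real \<Rightarrow> complex) \<Rightarrow> real \<Rightarrow> real \<Rightarrow> real \<Rightarrow> real \<Rightarrow> nat \<Rightarrow> complex Matrix.mat" where
  "Gtilde g \<delta> T \<tau>1 \<tau>2 N =
     four_block_mat (Gmat g \<delta> T 0 N) (Gmat g \<delta> T (\<tau>1 - \<tau>2) N)
                    (mat_adjoint (Gmat g \<delta> T (\<tau>1 - \<tau>2) N)) (Gmat g \<delta> T 0 N)"

definition Rtilde :: "(real \<Rightarrow> real) \<Rightarrow> (real \<Rightarrow> real) \<Rightarrow> nat \<Rightarrow> complex Matrix.mat" where
  "Rtilde S1 S2 N = four_block_mat (Rmat S1 N) (0\<^sub>m N N) (0\<^sub>m N N) (Rmat S2 N)"

text \<open>Normalized log-det (1/(2N)) log2 det(I + sigma0^{-2} G R); the determinant is real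
  positive for the PSD matrices involved, its real part is taken.\<close>
definition logdet_rate :: "real \<Rightarrow> nat \<Rightarrow> complex Matrix.mat \<Rightarrow> complex Matrix.mat \<Rightarrow> real" where
  "logdet_rate \<sigma>2 N G R =
     1 / (2 * real N) * log 2 (Re (Determinant.det (1\<^sub>m (dim_row G) + complex_of_real (1 / \<sigma>2) \<cdot>\<^sub>m (G * R))))"

definition admissible :: "(real \<Rightarrow> complex) \<Rightarrow> real \<Rightarrow> real \<Rightarrow> real \<Rightarrow> (real \<Rightarrow> real) \<Rightarrow> bool" where
  "admissible g \<delta> T P S \<longleftrightarrow>
     (\<forall>lam\<in>{-1/2..1/2}. S lam \<ge> 0 \<and> S (- lam) = S lam) \<and>
     S integrable_on {-1/2..1/2} \<and>
     (\<lambda>n::int. norm (fcoef S n)) summable_on UNIV \<and>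
     1 / (\<delta> * T) * integral {-1/2..1/2} (\<lambda>lam. Re (folded_spec g \<delta> T 0 lam) * S lam) \<le> P"

definition cap_region_lim :: "(real \<Rightarrow> complex) \<Rightarrow> real \<Rightarrow> real \<Rightarrow> real \<Rightarrow> real \<Rightarrow> real \<Rightarrow> real \<Rightarrow> real \<Rightarrow> (real \<times> real) set" where
  "cap_region_lim g \<delta> T \<tau>1 \<tau>2 \<sigma>2 P1 P2 =
     {(R1, R2). \<exists>Sa1 Sa2. admissible g \<delta> T P1 Sa1 \<and> admissible g \<delta> T P2 Sa2 \<and>
        0 \<le> R1 \<and> R1 \<le> lim (\<lambda>N. logdet_rate \<sigma>2 N (Gmat g \<delta> T 0 N) (Rmat Sa1 N)) \<and>
        0 \<le> R2 \<and> R2 \<le> lim (\<lambda>N. logdet_rate \<sigma>2 N (Gmat g \<delta> T 0 N) (Rmat Sa2 N)) \<and>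
        0 \<le> R1 + R2 \<and> R1 + R2 \<le> lim (\<lambda>N. logdet_rate \<sigma>2 N (Gtilde g \<delta> T \<tau>1 \<tau>2 N) (Rtilde Sa1 Sa2 N))}"

definition int_rate1 :: "(real \<Rightarrow> complex) \<Rightarrow> real \<Rightarrow> real \<Rightarrow> real \<Rightarrow> (real \<Rightarrow> real) \<Rightarrow> real" where
  "int_rate1 g \<delta> T \<sigma>2 Sa =
     1/2 * integral {-1/2..1/2} (\<lambda>lam. log 2 (1 + Re (folded_spec g \<delta> T 0 lam) * Sa lam / \<sigma>2))"

definition int_rate_sum :: "(real \<Rightarrow> complex) \<Rightarrow> real \<Rightarrow> real \<Rightarrow> real \<Rightarrow> real \<Rightarrow> real \<Rightarrow> (real \<Rightarrow> real) \<Rightarrow> (real \<Rightarrow> real) \<Rightarrow> real" where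
  "int_rate_sum g \<delta> T \<tau>1 \<tau>2 \<sigma>2 Sa1 Sa2 =
     1/2 * integral {-1/2..1/2} (\<lambda>lam.
       let G = folded_spec g \<delta> T 0 lam; G12 = folded_spec g \<delta> T (\<tau>1 - \<tau>2) lam;
           S1 = Re G * Sa1 lam; S2 = Re G * Sa2 lam
       in log 2 (1 + S1 / \<sigma>2 + S2 / \<sigma>2 + S1 * S2 / \<sigma>2\<^sup>2 * (1 - (cmod (G12 / G))\<^sup>2)))"

definition cap_region_int :: "(real \<Rightarrow> complex) \<Rightarrow> real \<Rightarrow> real \<Rightarrow> real \<Rightarrow> real \<Rightarrow> real \<Rightarrow> real \<Rightarrow> real \<Rightarrow> (real \<times> real) set" where
  "cap_region_int g \<delta> T \<tau>1 \<tau>2 \<sigma>2 P1 P2 =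
     {(R1, R2). \<exists>Sa1 Sa2. admissible g \<delta> T P1 Sa1 \<and> admissible g \<delta> T P2 Sa2 \<and>
        0 \<le> R1 \<and> R1 \<le> int_rate1 g \<delta> T \<sigma>2 Sa1 \<and>
        0 \<le> R2 \<and> R2 \<le> int_rate1 g \<delta> T \<sigma>2 Sa2 \<and>
        R1 + R2 \<le> int_rate_sum g \<delta> T \<tau>1 \<tau>2 \<sigma>2 Sa1 Sa2}"

end

theory Submission
  imports Defs
begin

text \<open>The argument is the moment method. The products of Toeplitz matrices in the log-determinants are
  products of two positive semidefinite matrices, so their eigenvalues are nonnegative, and they stay
  in a fixed interval \<open>[0, K]\<close> because the coefficients are absolutely summable. On this interval
  \<open>ln (1 + x)\<close> is a uniform limit of polynomials, so only the normalised traces of powers matter.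
  Up to an error that is \<open>o(N)\<close> in the entrywise \<open>1\<close>-norm, Toeplitz matrices multiply like their symbols,
  hence these traces converge to the zeroth Fourier coefficients, i.e. the integrals, of the traces of
  powers of the symbol. The same polynomial approximation, applied pointwise to the symbol (which is
  positive semidefinite as a limit of Cesaro means), identifies the limit. An admissible spectrum need
  not be continuous, but it agrees almost everywhere with the sum of its Fourier series. Where
  \<open>G\<^sub>\<delta>\<close> vanishes, positive semidefiniteness of the symbol forces the cross spectrum to vanish too, so
  the convention \<open>x / 0 = 0\<close> in the integrand is harmless.\<close>

no_notation Finite_Cartesian_Product.vec_nth (infixl \<open>$\<close> 90)
no_notation Infinite_Set_Sum.abs_summable_on (infix \<open>abs'_summable'_on\<close> 50)

subsection \<open>Eigenvalues, traces and positive semidefinite matrices\<close>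

text \<open>A product of two Hermitian matrices need not be Hermitian, so no orthogonal
  diagonalisation is at hand; Schur triangularisation supplies eigenvalues with multiplicity, and
  positivity of both factors puts them on the nonnegative real axis. The lemma that compares the
  determinant of a section with its moments also treats the symbol at one frequency, a matrix of
  fixed size: the same polynomial and the same \<open>K\<close> serve both, so no limiting
  eigenvalue distribution has to be identified. Everything is done for \<open>d\<close> by
  \<open>d\<close> matrix symbols; \<open>d = 1\<close> gives the single-user rates and
  \<open>d = 2\<close> the sum rate, with the noise level absorbed into the pulse coefficients and
  the delays into one offset per user. Positivity of the pulse sections comes from reading their
  quadratic form as the energy of a superposition of shifted pulses. Finally, \<open>fcoef\<close>
  and the Fourier series carry the same sign in the exponent, so summing the series of
  \<open>S\<close> yields \<open>S\<close> reflected at 0; evenness of admissible spectra undoes the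
  reflection and reduces Fourier uniqueness to polynomials in
  \<open>cos (2 * pi * x)\<close>.\<close>

definition mtrace :: "complex mat \<Rightarrow> complex" where
  "mtrace A = (\<Sum>i<dim_row A. A $$ (i, i))"

lemma index_mult_mat_lessThan:
  assumes "A \<in> carrier_mat n m" "B \<in> carrier_mat m k" "i < n" "j < k"
  shows "(A * B) $$ (i, j) = (\<Sum>l<m. A $$ (i, l) * B $$ (l, j))"
  using assms by (auto simp: scalar_prod_def lessThan_atLeast0 intro!: sum.cong)

lemma mtrace_mult_commute:
  assumes "A \<in> carrier_mat n n" "B \<in> carrier_mat n n"
  shows "mtrace (A * B) = mtrace (B * A)"
proof -
  have "mtrace (A * B) = (\<Sum>i<n. \<Sum>l<n. A $$ (i, l) * B $$ (l, i))"
    using assms by (auto simp: mtrace_def index_mult_mat_lessThan simp del: index_mult_mat(1) intro!: sum.cong)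
  also have "\<dots> = (\<Sum>l<n. \<Sum>i<n. B $$ (l, i) * A $$ (i, l))"
    by (subst sum.swap) (simp add: mult.commute)
  also have "\<dots> = mtrace (B * A)"
    using assms by (auto simp: mtrace_def index_mult_mat_lessThan simp del: index_mult_mat(1) intro!: sum.cong)
  finally show ?thesis .
qed

lemma upper_triangular_mult:
  assumes A: "A \<in> carrier_mat n n" "upper_triangular A"
    and B: "B \<in> carrier_mat n n" "upper_triangular B"
  shows "upper_triangular (A * B)"
    and "i < n \<Longrightarrow> (A * B) $$ (i, i) = A $$ (i, i) * (B $$ (i, i) :: 'a :: comm_ring_1)"
proof -
  show "upper_triangular (A * B)"
  proof
    fix i j assume ij: "j < i" "i < dim_row (A * B)"
    have "(A * B) $$ (i, j) = (\<Sum>l<n. A $$ (i, l) * B $$ (l, j))"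
      by (rule index_mult_mat_lessThan[of _ n n _ n]) (use A B ij in auto)
    also have "\<dots> = 0"
    proof (intro sum.neutral ballI)
      fix l assume "l \<in> {..<n}"
      show "A $$ (i, l) * B $$ (l, j) = 0"
      proof (cases "l < i")
        case True
        thus ?thesis using upper_triangularD[OF A(2), of l i] ij A by auto
      next
        case False
        thus ?thesis using upper_triangularD[OF B(2), of j l] ij B \<open>l \<in> {..<n}\<close> by auto
      qed
    qed
    finally show "(A * B) $$ (i, j) = 0" .
  qed
  assume i: "i < n"
  have "(A * B) $$ (i, i) = (\<Sum>l<n. A $$ (i, l) * B $$ (l, i))"
    using A B i by (intro index_mult_mat_lessThan) auto
  also have "\<dots> = (\<Sum>l\<in>{i}. A $$ (i, l) * B $$ (l, i))"
  proof (intro sum.mono_neutral_right ballI)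
    fix l assume l: "l \<in> {..<n} - {i}"
    show "A $$ (i, l) * B $$ (l, i) = 0"
      using upper_triangularD[OF A(2), of l i] upper_triangularD[OF B(2), of i l] i A B l
      by (cases "l < i") auto
  qed (use i in auto)
  finally show "(A * B) $$ (i, i) = A $$ (i, i) * B $$ (i, i)" by simp
qed

lemma upper_triangular_pow:
  fixes B :: "'a :: comm_ring_1 mat"
  assumes B: "B \<in> carrier_mat n n" "upper_triangular B"
  shows "upper_triangular (B ^\<^sub>m k) \<and> (\<forall>i<n. (B ^\<^sub>m k) $$ (i, i) = B $$ (i, i) ^ k)"
proof (induction k)
  case 0
  show ?case using B by auto
next
  case (Suc k)
  have "B ^\<^sub>m k \<in> carrier_mat n n" using B by simp
  with Suc upper_triangular_mult[OF this _ B] show ?case by (auto simp: mult.commute)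
qed

text \<open>\<open>A\<close> is similar to an upper triangular \<open>B\<close>; the values
  \<open>ev i\<close> are the diagonal entries of \<open>B\<close>. Determinants and traces of
  powers are invariant under similarity and can be read off that diagonal, so diagonalisability of
  \<open>A\<close> never enters.\<close>

lemma complex_mat_spectrum:
  fixes A :: "complex mat"
  assumes A: "A \<in> carrier_mat n n"
  obtains ev :: "nat \<Rightarrow> complex" where
    "\<And>i. i < n \<Longrightarrow> eigenvalue A (ev i)"
    "det (1\<^sub>m n + A) = (\<Prod>i<n. 1 + ev i)"
    "\<And>k. mtrace (A ^\<^sub>m k) = (\<Sum>i<n. ev i ^ k)"
proof -
  obtain es where es: "char_poly A = (\<Prod>a\<leftarrow>es. [:- a, 1:])" "length es = n"
    using char_poly_factorized[OF A] by blast
  obtain B P Q where schur: "schur_decomposition A es = (B, P, Q)"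
    by (cases "schur_decomposition A es") auto
  note sd = schur_decomposition[OF A es(1) schur]
  hence sim: "similar_mat_wit A B P Q" and ut: "upper_triangular B" and dg: "diag_mat B = es" by auto
  note w = similar_mat_witD2[OF A sim]
  define ev where "ev i = B $$ (i, i)" for i
  have es_nth: "es ! i = ev i" if "i < n" for i
    using dg that w(5) by (auto simp: diag_mat_def ev_def)
  show ?thesis
  proof
    fix i assume i: "i < n"
    have "ev i \<in> set es" using es_nth[OF i] i es(2) by (metis nth_mem)
    hence "poly (char_poly A) (ev i) = 0"
      unfolding es(1) poly_prod_list by (force simp: prod_list_zero_iff)
    thus "eigenvalue A (ev i)" by (simp add: eigenvalue_root_char_poly[OF A])
  next
    have "1\<^sub>m n + A = P * (1\<^sub>m n + B) * Q"
    proof -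
      have "P * (1\<^sub>m n + B) * Q = (P * 1\<^sub>m n + P * B) * Q"
        using w by (subst mult_add_distrib_mat[of _ n n _ n]) auto
      also have "\<dots> = P * 1\<^sub>m n * Q + P * B * Q"
        using w by (subst add_mult_distrib_mat[of _ n n _ _ n]) auto
      finally show ?thesis using w by simp
    qed
    hence "similar_mat (1\<^sub>m n + A) (1\<^sub>m n + B)"
      using w by (intro similar_matI[of _ _ P Q n]) auto
    hence "det (1\<^sub>m n + A) = det (1\<^sub>m n + B)" by (rule det_similar)
    also have "\<dots> = prod_list (diag_mat (1\<^sub>m n + B))"
    proof (rule det_upper_triangular[of _ n])
      show "upper_triangular (1\<^sub>m n + B)"
        using w(5) upper_triangularD[OF ut] by (intro upper_triangularI) auto
    qed (use w(5) in auto)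
    also have "\<dots> = (\<Prod>i<n. 1 + ev i)"
      unfolding prod_list_diag_prod using w(5) by (auto simp: ev_def lessThan_atLeast0 intro!: prod.cong)
    finally show "det (1\<^sub>m n + A) = (\<Prod>i<n. 1 + ev i)" .
  next
    fix k
    have Bk: "B ^\<^sub>m k \<in> carrier_mat n n" using w(5) by simp
    have "mtrace (A ^\<^sub>m k) = mtrace (P * (B ^\<^sub>m k * Q))"
      using similar_mat_wit_pow_id[OF sim, of k] w Bk by (simp add: assoc_mult_mat[of _ n n _ n _ n])
    also have "\<dots> = mtrace (B ^\<^sub>m k * Q * P)"
      using w Bk by (intro mtrace_mult_commute[of _ n]) auto
    also have "B ^\<^sub>m k * Q * P = B ^\<^sub>m k"
      using w Bk by (simp add: assoc_mult_mat[of _ n n _ n _ n])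
    also have "mtrace (B ^\<^sub>m k) = (\<Sum>i<n. ev i ^ k)"
      using upper_triangular_pow[OF w(5) ut, of k] w(5) by (simp add: mtrace_def ev_def)
    finally show "mtrace (A ^\<^sub>m k) = (\<Sum>i<n. ev i ^ k)" .
  qed
qed

section \<open>Positive semidefinite forms and the eigenvalues of their products\<close>

definition sesq :: "nat \<Rightarrow> complex mat \<Rightarrow> (nat \<Rightarrow> complex) \<Rightarrow> (nat \<Rightarrow> complex) \<Rightarrow> complex" where
  "sesq n A u v = (\<Sum>i<n. \<Sum>j<n. cnj (u i) * A $$ (i, j) * v j)"

text \<open>Positivity is asked of the real part only; the Hermitian clause makes the form real on
  the diagonal (\<open>psd_sesq_Im\<close>). Vectors are plain functions, which suits the later
  splitting of indices into blocks.\<close>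

definition psd :: "nat \<Rightarrow> complex mat \<Rightarrow> bool" where
  "psd n A \<longleftrightarrow> A \<in> carrier_mat n n \<and> (\<forall>i<n. \<forall>j<n. A $$ (j, i) = cnj (A $$ (i, j)))
     \<and> (\<forall>v. 0 \<le> Re (sesq n A v v))"

lemma psd_sesq_cnj:
  assumes "psd n A"
  shows "cnj (sesq n A u v) = sesq n A v u"
proof -
  have "cnj (A $$ (i, j)) = A $$ (j, i)" if "i < n" "j < n" for i j
    using assms that unfolding psd_def by metis
  hence "cnj (sesq n A u v) = (\<Sum>i<n. \<Sum>j<n. cnj (v j) * A $$ (j, i) * u i)"
    by (auto simp: sesq_def mult_ac intro!: sum.cong)
  also have "\<dots> = sesq n A v u"
    unfolding sesq_def by (rule sum.swap)
  finally show ?thesis .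
qed

lemma psd_sesq_Im: "psd n A \<Longrightarrow> Im (sesq n A v v) = 0"
  using psd_sesq_cnj[of n A v v] by (simp add: complex_eq_iff)

text \<open>\<open>v\<close> minimises the form, so moving from \<open>v\<close> along
  \<open>- t * w\<close> with \<open>w = A v\<close> cannot decrease it. The first-order change is
  \<open>- 2 * t * s\<close> with \<open>s\<close> the squared norm of \<open>w\<close>, which
  forces \<open>s = 0\<close>.\<close>

lemma psd_kernel:
  assumes A: "psd n A" and v: "sesq n A v v = 0" and i: "i < n"
  shows "(\<Sum>j<n. A $$ (i, j) * v j) = 0"
proof -
  define w where "w i = (\<Sum>j<n. A $$ (i, j) * v j)" for i
  define s where "s = (\<Sum>i<n. (cmod (w i))\<^sup>2)"
  define q where "q = Re (sesq n A w w)"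
  have wv: "sesq n A w v = of_real s"
  proof -
    have "sesq n A w v = (\<Sum>i<n. cnj (w i) * w i)"
      unfolding sesq_def mult.assoc sum_distrib_left[symmetric] by (simp add: w_def)
    also have "\<dots> = of_real s"
      unfolding s_def of_real_sum complex_norm_square by (simp add: mult.commute)
    finally show ?thesis .
  qed
  hence vw: "sesq n A v w = of_real s"
    using psd_sesq_cnj[OF A, of w v] by simp
  have q0: "q \<ge> 0" using A by (simp add: psd_def q_def)
  have s0: "s \<ge> 0" by (simp add: s_def sum_nonneg)
  have ineq: "0 \<le> - 2 * t * s + t\<^sup>2 * q" for t :: real
  proof -
    have "sesq n A (\<lambda>i. v i - of_real t * w i) (\<lambda>i. v i - of_real t * w i)
       = sesq n A v v - of_real t * sesq n A w v - of_real t * sesq n A v w + of_real (t\<^sup>2) * sesq n A w w"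
      by (simp add: sesq_def algebra_simps sum.distrib sum_subtractf sum_distrib_left power2_eq_square)
    also have "Re \<dots> = - 2 * t * s + t\<^sup>2 * q"
      by (simp add: v wv vw q_def)
    finally have "Re (sesq n A (\<lambda>i. v i - of_real t * w i) (\<lambda>i. v i - of_real t * w i))
      = - 2 * t * s + t\<^sup>2 * q" .
    moreover have "0 \<le> Re (sesq n A (\<lambda>i. v i - of_real t * w i) (\<lambda>i. v i - of_real t * w i))"
      using A unfolding psd_def by blast
    ultimately show ?thesis by linarith
  qed
  have "s = 0"
  proof (rule ccontr)
    assume "s \<noteq> 0"
    hence s: "s > 0" using s0 by simp
    \<comment> \<open>Small enough that the quadratic term \<open>t^2 * q\<close> is at most
      \<open>t * s\<close>, half of the linear one; the added 1 keeps the denominator positive when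
      \<open>q = 0\<close>.\<close>
    define t where "t = s / (q + 1)"
    have t: "t > 0" using s q0 by (simp add: t_def)
    have "t * q \<le> s" using q0 s by (simp add: t_def field_simps)
    hence "t * (t * q) \<le> t * s" using t by (intro mult_left_mono) auto
    with ineq[of t] have "t * s \<le> 0" by (simp add: power2_eq_square algebra_simps)
    thus False using t s by (simp add: mult_le_0_iff)
  qed
  hence "(cmod (w i))\<^sup>2 = 0"
    unfolding s_def using i by (subst (asm) sum_nonneg_eq_0_iff) auto
  thus ?thesis by (simp add: w_def)
qed

text \<open>With \<open>A B x = k x\<close> and \<open>y = B x\<close>, the form of \<open>A\<close>
  at \<open>y\<close> equals \<open>k\<close> times the form of \<open>B\<close> at
  \<open>x\<close>, so \<open>k\<close> is a quotient of nonnegative reals. If the denominator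
  vanishes, then \<open>B x = 0\<close> by \<open>psd_kernel\<close>, hence \<open>k x = 0\<close>
  and \<open>k = 0\<close>.\<close>

lemma psd_mult_eigenvalue_nonneg:
  assumes A: "psd n A" and B: "psd n B" and ev: "eigenvalue (A * B) k"
  shows "k = of_real (Re k)" "Re k \<ge> 0"
proof -
  have cA: "A \<in> carrier_mat n n" and cB: "B \<in> carrier_mat n n"
    using A B by (auto simp: psd_def)
  obtain x where x: "x \<in> carrier_vec n" "x \<noteq> 0\<^sub>v n" "(A * B) *\<^sub>v x = k \<cdot>\<^sub>v x"
    using ev cA cB by (auto simp: eigenvalue_def eigenvector_def)
  define y where "y i = (\<Sum>j<n. B $$ (i, j) * x $ j)" for i
  have eq: "(\<Sum>l<n. A $$ (i, l) * y l) = k * x $ i" if i: "i < n" for i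
  proof -
    have Bx: "(B *\<^sub>v x) $ l = y l" if "l < n" for l
      using that cB x(1) by (auto simp: y_def scalar_prod_def lessThan_atLeast0 intro!: sum.cong)
    have "(A * B) *\<^sub>v x = A *\<^sub>v (B *\<^sub>v x)" using cA cB x(1) by simp
    hence "(A *\<^sub>v (B *\<^sub>v x)) $ i = (k \<cdot>\<^sub>v x) $ i" using x(3) by simp
    moreover have "(A *\<^sub>v (B *\<^sub>v x)) $ i = (\<Sum>l<n. A $$ (i, l) * (B *\<^sub>v x) $ l)"
      using i cA cB x(1) by (auto simp: scalar_prod_def lessThan_atLeast0 intro!: sum.cong)
    ultimately show ?thesis using i x(1) Bx by simp
  qed
  have "sesq n A y y = (\<Sum>i<n. cnj (y i) * (k * x $ i))"
    unfolding sesq_def mult.assoc sum_distrib_left[symmetric] using eq by simp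
  also have "\<dots> = k * cnj (sesq n B (\<lambda>i. x $ i) (\<lambda>i. x $ i))"
    by (simp add: sesq_def y_def sum_distrib_left sum_distrib_right mult_ac)
  also have "\<dots> = k * sesq n B (\<lambda>i. x $ i) (\<lambda>i. x $ i)"
    using psd_sesq_cnj[OF B] by simp
  finally have *: "sesq n A y y = k * sesq n B (\<lambda>i. x $ i) (\<lambda>i. x $ i)" .
  define a where "a = Re (sesq n A y y)"
  define b where "b = Re (sesq n B (\<lambda>i. x $ i) (\<lambda>i. x $ i))"
  have ab: "of_real a = k * of_real b" and ge: "a \<ge> 0" "b \<ge> 0"
  proof -
    have "sesq n A y y = of_real a" "sesq n B (\<lambda>i. x $ i) (\<lambda>i. x $ i) = of_real b"
      by (simp_all add: complex_eq_iff a_def b_def psd_sesq_Im[OF A] psd_sesq_Im[OF B])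
    with * show "of_real a = k * of_real b" by simp
  qed (use A B in \<open>auto simp: a_def b_def psd_def\<close>)
  have "k = of_real (Re k) \<and> Re k \<ge> 0"
  proof (cases "b = 0")
    case True
    hence "sesq n B (\<lambda>i. x $ i) (\<lambda>i. x $ i) = 0"
      by (simp add: complex_eq_iff b_def psd_sesq_Im[OF B])
    hence "y i = 0" if "i < n" for i using psd_kernel[OF B _ that] that by (simp add: y_def)
    hence kx: "k * x $ i = 0" if "i < n" for i using eq[OF that] that by simp
    have "k = 0"
    proof (rule ccontr)
      assume "k \<noteq> 0"
      hence "x = 0\<^sub>v n" using kx x(1) by (intro eq_vecI) auto
      thus False using x(2) by simp
    qed
    thus ?thesis by simp
  next
    case False
    hence "k = of_real (a / b)" using ab by (simp add: field_simps)
    thus ?thesis using ge by simp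
  qed
  thus "k = of_real (Re k)" "Re k \<ge> 0" by auto
qed

text \<open>Compare both sides of the eigenvector equation at a coordinate of largest modulus. This
  bound survives without any Hermitian structure and does not see the dimension.\<close>

lemma eigenvalue_le_row_sum:
  fixes A :: "complex mat"
  assumes A: "A \<in> carrier_mat n n" and ev: "eigenvalue A k"
    and K: "\<And>i. i < n \<Longrightarrow> (\<Sum>j<n. cmod (A $$ (i, j))) \<le> K"
  shows "cmod k \<le> K"
proof -
  obtain x where x: "x \<in> carrier_vec n" "x \<noteq> 0\<^sub>v n" "A *\<^sub>v x = k \<cdot>\<^sub>v x"
    using ev A by (auto simp: eigenvalue_def eigenvector_def)
  have "\<exists>l<n. x $ l \<noteq> 0"
  proof (rule ccontr)
    assume "\<not> ?thesis"
    hence "x = 0\<^sub>v n" using x(1) by (intro eq_vecI) auto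
    thus False using x(2) by simp
  qed
  then obtain l where l: "l < n" "x $ l \<noteq> 0" by blast
  define M where "M = Max ((\<lambda>i. cmod (x $ i)) ` {..<n})"
  have "M \<in> (\<lambda>i. cmod (x $ i)) ` {..<n}" unfolding M_def using l by (intro Max_in) auto
  then obtain i where i: "i < n" "cmod (x $ i) = M" by auto
  have le: "cmod (x $ j) \<le> M" if "j < n" for j
    unfolding M_def using that by (intro Max_ge) auto
  have M: "M > 0" using le[OF l(1)] l(2) by (meson zero_less_norm_iff less_le_trans)
  have "(A *\<^sub>v x) $ i = k * x $ i" using x i by simp
  moreover have "(A *\<^sub>v x) $ i = (\<Sum>j<n. A $$ (i, j) * x $ j)"
    using A x(1) i by (auto simp: scalar_prod_def lessThan_atLeast0 intro!: sum.cong)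
  ultimately have "cmod k * M = cmod (\<Sum>j<n. A $$ (i, j) * x $ j)"
    using i(2) by (simp add: norm_mult)
  also have "\<dots> \<le> (\<Sum>j<n. cmod (A $$ (i, j)) * M)"
    by (intro order.trans[OF norm_sum] sum_mono) (auto simp: norm_mult intro!: mult_left_mono le)
  also have "\<dots> \<le> K * M"
    using K[OF i(1)] M by (simp flip: sum_distrib_right)
  finally show ?thesis using M by simp
qed

text \<open>Trades the log-determinant of a product of positive semidefinite matrices for finitely many
  moments, uniformly in the dimension.\<close>

lemma ln_det_moment_approx:
  assumes A: "psd n A" and B: "psd n B"
    and K: "\<And>i. i < n \<Longrightarrow> (\<Sum>j<n. cmod ((A * B) $$ (i, j))) \<le> K"
    and approx: "\<And>x. 0 \<le> x \<Longrightarrow> x \<le> K \<Longrightarrow> \<bar>ln (1 + x) - (\<Sum>k\<le>m. c k * x ^ k)\<bar> \<le> \<epsilon>"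
  shows "1 \<le> Re (det (1\<^sub>m n + A * B))"
    and "\<bar>ln (Re (det (1\<^sub>m n + A * B))) - (\<Sum>k\<le>m. c k * Re (mtrace ((A * B) ^\<^sub>m k)))\<bar> \<le> real n * \<epsilon>"
proof -
  have AB: "A * B \<in> carrier_mat n n" using A B by (auto simp: psd_def)
  obtain ev where ev: "\<And>i. i < n \<Longrightarrow> eigenvalue (A * B) (ev i)"
    and det: "det (1\<^sub>m n + A * B) = (\<Prod>i<n. 1 + ev i)"
    and tr: "\<And>k. mtrace ((A * B) ^\<^sub>m k) = (\<Sum>i<n. ev i ^ k)"
    using complex_mat_spectrum[OF AB] by blast
  define r where "r i = Re (ev i)" for i
  have ev_r: "ev i = of_real (r i)" and r0: "r i \<ge> 0" if "i < n" for i
    using psd_mult_eigenvalue_nonneg[OF A B ev[OF that]] by (simp_all add: r_def)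
  have rK: "r i \<le> K" if "i < n" for i
    using eigenvalue_le_row_sum[OF AB ev[OF that] K] ev_r[OF that] r0[OF that] by simp
  have "det (1\<^sub>m n + A * B) = of_real (\<Prod>i<n. 1 + r i)"
    unfolding det of_real_prod by (intro prod.cong) (auto simp: ev_r)
  hence Re_det: "Re (det (1\<^sub>m n + A * B)) = (\<Prod>i<n. 1 + r i)" by (metis Re_complex_of_real)
  show "1 \<le> Re (det (1\<^sub>m n + A * B))"
    unfolding Re_det by (intro prod_ge_1) (auto simp: r0)
  have "ln (Re (det (1\<^sub>m n + A * B))) = (\<Sum>i<n. ln (1 + r i))"
    unfolding Re_det by (subst ln_prod) (use r0 in \<open>force simp: add_nonneg_eq_0_iff\<close>)+
  moreover have "Re (mtrace ((A * B) ^\<^sub>m k)) = (\<Sum>i<n. r i ^ k)" for k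
  proof -
    have "mtrace ((A * B) ^\<^sub>m k) = of_real (\<Sum>i<n. r i ^ k)" by (simp add: tr ev_r)
    thus ?thesis by (metis Re_complex_of_real)
  qed
  hence "(\<Sum>k\<le>m. c k * Re (mtrace ((A * B) ^\<^sub>m k))) = (\<Sum>i<n. \<Sum>k\<le>m. c k * r i ^ k)"
    by (simp add: sum_distrib_left) (rule sum.swap)
  ultimately have "\<bar>ln (Re (det (1\<^sub>m n + A * B))) - (\<Sum>k\<le>m. c k * Re (mtrace ((A * B) ^\<^sub>m k)))\<bar>
      = \<bar>\<Sum>i<n. ln (1 + r i) - (\<Sum>k\<le>m. c k * r i ^ k)\<bar>"
    by (simp add: sum_subtractf)
  also have "\<dots> \<le> (\<Sum>i<n. \<bar>ln (1 + r i) - (\<Sum>k\<le>m. c k * r i ^ k)\<bar>)" by (rule sum_abs)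
  also have "\<dots> \<le> (\<Sum>i<n. \<epsilon>)" by (intro sum_mono approx) (auto simp: r0 rK)
  finally show "\<bar>ln (Re (det (1\<^sub>m n + A * B))) - (\<Sum>k\<le>m. c k * Re (mtrace ((A * B) ^\<^sub>m k)))\<bar> \<le> real n * \<epsilon>"
    by simp
qed

subsection \<open>Absolutely summable sequences and finite Toeplitz sections\<close>

definition fchar :: "real \<Rightarrow> int \<Rightarrow> complex" where
  "fchar x n = exp (\<i> * complex_of_real (2 * pi * x * real_of_int n))"

lemma norm_fchar [simp]: "cmod (fchar x n) = 1"
  by (simp add: fchar_def)

lemma fchar_0 [simp]: "fchar x 0 = 1"
  by (simp add: fchar_def)

lemma fchar_add: "fchar x (m + n) = fchar x m * fchar x n"
  by (simp add: fchar_def distrib_left exp_add)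

lemma cnj_fchar: "cnj (fchar x n) = fchar x (- n)"
  by (simp add: fchar_def exp_cnj)

lemma fchar_uminus_arg: "fchar (- x) n = fchar x (- n)"
  by (simp add: fchar_def)

lemma continuous_on_fchar [continuous_intros]: "continuous_on S (\<lambda>x. fchar x n)"
  unfolding fchar_def by (intro continuous_intros)

lemma summable_on_int_shift:
  fixes f :: "int \<Rightarrow> 'a :: {comm_monoid_add, topological_space}"
  shows "(\<lambda>n. f (n - m)) summable_on UNIV \<longleftrightarrow> f summable_on UNIV"
    and "(\<lambda>n. f (m - n)) summable_on UNIV \<longleftrightarrow> f summable_on UNIV"
  by (rule summable_on_reindex_bij_betw; rule bij_betwI[of _ _ _ "\<lambda>n. n + m"]; simp)
     (rule summable_on_reindex_bij_betw; rule bij_betwI[of _ _ _ "\<lambda>n. m - n"]; simp)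

lemma infsum_int_shift:
  fixes f :: "int \<Rightarrow> 'a :: {comm_monoid_add, t2_space}"
  shows "(\<Sum>\<^sub>\<infinity>n. f (n - m)) = infsum f UNIV"
    and "(\<Sum>\<^sub>\<infinity>n. f (m - n)) = infsum f UNIV"
  by (rule infsum_reindex_bij_betw; rule bij_betwI[of _ _ _ "\<lambda>n. n + m"]; simp)
     (rule infsum_reindex_bij_betw; rule bij_betwI[of _ _ _ "\<lambda>n. m - n"]; simp)

lemma abs_summable_on_int_shift [simp]:
  fixes f :: "int \<Rightarrow> complex"
  shows "(\<lambda>n. f (n - m)) abs_summable_on UNIV \<longleftrightarrow> f abs_summable_on UNIV"
    and "(\<lambda>n. f (m - n)) abs_summable_on UNIV \<longleftrightarrow> f abs_summable_on UNIV"
  using summable_on_int_shift[of "\<lambda>n. norm (f n)" m] by simp_all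

lemma infsum_compl_split:
  fixes f :: "'a \<Rightarrow> 'b :: banach"
  assumes "f summable_on UNIV"
  shows "infsum f UNIV = infsum f S + infsum f (- S)"
  using infsum_Un_disjoint[of f S "- S"] summable_on_subset_banach[OF assms] by auto

lemma has_sum_sum:
  fixes f :: "'i \<Rightarrow> 'a \<Rightarrow> 'b :: topological_comm_monoid_add"
  assumes "finite I" "\<And>i. i \<in> I \<Longrightarrow> (f i has_sum s i) A"
  shows "((\<lambda>x. \<Sum>i\<in>I. f i x) has_sum (\<Sum>i\<in>I. s i)) A"
  using assms by (induction I rule: finite_induct) (auto intro!: has_sum_add)

definition iconv :: "(int \<Rightarrow> complex) \<Rightarrow> (int \<Rightarrow> complex) \<Rightarrow> int \<Rightarrow> complex" where
  "iconv u v n = (\<Sum>\<^sub>\<infinity>m. u m * v (n - m))"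

text \<open>The family \<open>u m * v (n - m)\<close> is absolutely summable over all pairs, since
  for fixed \<open>m\<close> its mass is \<open>norm (u m)\<close> times the mass of
  \<open>v\<close>. Both claims follow by summing the pairs in the other order; for the second,
  \<open>fchar x n\<close> splits as \<open>fchar x m * fchar x (n - m)\<close>.\<close>

lemma
  fixes u v :: "int \<Rightarrow> complex"
  assumes u: "u abs_summable_on UNIV" and v: "v abs_summable_on UNIV"
  shows iconv_abs_summable: "iconv u v abs_summable_on UNIV"
    and iconv_fourier: "(\<Sum>\<^sub>\<infinity>n. iconv u v n * fchar x n)
          = (\<Sum>\<^sub>\<infinity>n. u n * fchar x n) * (\<Sum>\<^sub>\<infinity>n. v n * fchar x n)"
proof -
  have F: "(\<lambda>(m, n). u m * v (n - m)) abs_summable_on UNIV \<times> UNIV"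
    unfolding Infinite_Sum.abs_summable_on_Sigma_iff
    using u v infsum_int_shift(1)[of "\<lambda>n. norm (v n)"]
    by (auto simp: norm_mult infsum_cmult_right' abs_mult
        intro!: summable_on_cmult_right summable_on_cmult_left)
  hence F': "(\<lambda>(n, m). u m * v (n - m)) abs_summable_on UNIV \<times> UNIV"
    using summable_on_swap[of "\<lambda>(m, n). norm (u m * v (n - m))" UNIV UNIV]
    by (simp add: case_prod_unfold)
  have inner: "(\<lambda>m. u m * v (n - m)) abs_summable_on UNIV" for n
    using F' unfolding Infinite_Sum.abs_summable_on_Sigma_iff by auto
  have "(\<lambda>n. \<Sum>\<^sub>\<infinity>m. norm (u m * v (n - m))) abs_summable_on UNIV"
    using F' unfolding Infinite_Sum.abs_summable_on_Sigma_iff by auto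
  thus "iconv u v abs_summable_on UNIV"
  proof (rule Infinite_Sum.abs_summable_on_comparison_test)
    fix n
    show "norm (iconv u v n) \<le> norm (\<Sum>\<^sub>\<infinity>m. norm (u m * v (n - m)))"
      unfolding iconv_def using norm_infsum_bound[OF inner[of n]] by simp
  qed
  have "(\<lambda>(n, m). u m * v (n - m) * fchar x n) abs_summable_on UNIV \<times> UNIV"
    using F' by (simp add: case_prod_unfold norm_mult)
  hence G: "(\<lambda>(n, m). u m * v (n - m) * fchar x n) summable_on UNIV \<times> UNIV"
    by (rule Infinite_Sum.abs_summable_summable)
  have "(\<Sum>\<^sub>\<infinity>n. iconv u v n * fchar x n) = (\<Sum>\<^sub>\<infinity>n. \<Sum>\<^sub>\<infinity>m. u m * v (n - m) * fchar x n)"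
    unfolding iconv_def by (simp add: infsum_cmult_left')
  also have "\<dots> = (\<Sum>\<^sub>\<infinity>m. \<Sum>\<^sub>\<infinity>n. u m * v (n - m) * fchar x n)"
    by (rule infsum_swap_banach[OF G])
  also have "\<dots> = (\<Sum>\<^sub>\<infinity>m. u m * fchar x m * (\<Sum>\<^sub>\<infinity>n. v n * fchar x n))"
  proof (rule infsum_cong)
    fix m
    have "(\<Sum>\<^sub>\<infinity>n. u m * v (n - m) * fchar x n)
        = (\<Sum>\<^sub>\<infinity>n. u m * fchar x m * (v (n - m) * fchar x (n - m)))"
    proof (rule infsum_cong)
      fix n
      have "fchar x n = fchar x m * fchar x (n - m)" by (simp flip: fchar_add)
      thus "u m * v (n - m) * fchar x n = u m * fchar x m * (v (n - m) * fchar x (n - m))"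
        by simp
    qed
    also have "\<dots> = u m * fchar x m * (\<Sum>\<^sub>\<infinity>n. v (n - m) * fchar x (n - m))"
      by (rule infsum_cmult_right')
    also have "(\<Sum>\<^sub>\<infinity>n. v (n - m) * fchar x (n - m)) = (\<Sum>\<^sub>\<infinity>n. v n * fchar x n)"
      by (rule infsum_int_shift(1))
    finally show "(\<Sum>\<^sub>\<infinity>n. u m * v (n - m) * fchar x n)
        = u m * fchar x m * (\<Sum>\<^sub>\<infinity>n. v n * fchar x n)" .
  qed
  also have "\<dots> = (\<Sum>\<^sub>\<infinity>n. u n * fchar x n) * (\<Sum>\<^sub>\<infinity>n. v n * fchar x n)"
    by (rule infsum_cmult_left')
  finally show "(\<Sum>\<^sub>\<infinity>n. iconv u v n * fchar x n)
          = (\<Sum>\<^sub>\<infinity>n. u n * fchar x n) * (\<Sum>\<^sub>\<infinity>n. v n * fchar x n)" .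
qed

text \<open>The mass that truncation discards: the entries of the bi-infinite Toeplitz matrix of
  \<open>u\<close> in rows \<open>0\<close> to \<open>N - 1\<close> whose column lies outside that
  range.\<close>

definition edge :: "(int \<Rightarrow> complex) \<Rightarrow> nat \<Rightarrow> real" where
  "edge u N = (\<Sum>i<N. \<Sum>\<^sub>\<infinity>l\<in>- {0..<int N}. cmod (u (int i - l)))"

lemma abs_summable_on_int_subset:
  fixes u :: "int \<Rightarrow> complex"
  assumes "u abs_summable_on UNIV"
  shows "(\<lambda>l. cmod (u (k - l))) summable_on S" "(\<lambda>l. cmod (u (l - k))) summable_on S"
  by (rule summable_on_subset_banach[where A = UNIV]; use assms in simp)+

lemma edge_nonneg: "edge u N \<ge> 0"
  unfolding edge_def by (intro sum_nonneg infsum_nonneg) auto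

text \<open>All rows except a bounded number at either end see only the tail of the coefficients.\<close>

lemma edge_o:
  assumes u: "u abs_summable_on UNIV"
  shows "(\<lambda>N. edge u N / real N) \<longlonglongrightarrow> 0"
proof (rule LIMSEQ_I)
  fix \<epsilon> :: real assume \<epsilon>: "\<epsilon> > 0"
  define U where "U = (\<Sum>\<^sub>\<infinity>n. cmod (u n))"
  have U0: "U \<ge> 0" unfolding U_def by (intro infsum_nonneg) auto
  \<comment> \<open>\<open>F\<close> carries all of the mass \<open>U\<close> but
    \<open>\<epsilon> / 2\<close>, and \<open>K\<close> below is a radius containing
    \<open>F\<close>. A row at distance more than about \<open>K\<close> from both ends discards
    only indices outside \<open>F\<close>; the at most \<open>2 * K\<close> remaining rows are
    charged the full \<open>U\<close>.\<close>
  obtain F where F: "finite F" "dist (\<Sum>n\<in>F. cmod (u n)) U \<le> \<epsilon> / 2"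
    using infsum_finite_approximation[OF u, of "\<epsilon> / 2"] \<epsilon> unfolding U_def by auto
  obtain K where K: "\<And>n. n \<in> F \<Longrightarrow> \<bar>n\<bar> \<le> int K"
  proof -
    have "\<bar>n\<bar> \<le> int (nat (\<Sum>n\<in>F. \<bar>n\<bar>))" if "n \<in> F" for n
      using member_le_sum[OF that, of abs] F(1) by (simp add: sum_nonneg)
    thus ?thesis using that by blast
  qed
  have tail: "(\<Sum>\<^sub>\<infinity>l\<in>- {0..<int N}. cmod (u (int i - l))) \<le> \<epsilon> / 2"
    if i: "K \<le> i" "i + K < N" for i N
  proof -
    have "(\<Sum>\<^sub>\<infinity>l\<in>- {0..<int N}. cmod (u (int i - l))) = (\<Sum>\<^sub>\<infinity>n\<in>(\<lambda>l. int i - l) ` (- {0..<int N}). cmod (u n))"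
      by (subst infsum_reindex) (auto simp: inj_on_def o_def)
    also have "\<dots> \<le> (\<Sum>\<^sub>\<infinity>n\<in>- F. cmod (u n))"
    proof (rule infsum_mono2)
      show "(\<lambda>l. int i - l) ` (- {0..<int N}) \<subseteq> - F"
      proof (clarsimp)
        fix l assume "0 \<le> l \<longrightarrow> \<not> l < int N" "int i - l \<in> F"
        thus False using K[of "int i - l"] i by auto
      qed
    qed (use summable_on_subset_banach[OF u] in auto)
    also have "\<dots> = U - (\<Sum>n\<in>F. cmod (u n))"
    proof -
      have "U = (\<Sum>\<^sub>\<infinity>n\<in>F. cmod (u n)) + (\<Sum>\<^sub>\<infinity>n\<in>- F. cmod (u n))"
        unfolding U_def by (rule infsum_compl_split[OF u])
      thus ?thesis using F(1) by simp
    qed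
    also have "\<dots> \<le> \<epsilon> / 2" using F(2) unfolding dist_real_def by linarith
    finally show ?thesis .
  qed
  have full: "(\<Sum>\<^sub>\<infinity>l\<in>- {0..<int N}. cmod (u (int i - l))) \<le> U" for i N
  proof -
    have "(\<Sum>\<^sub>\<infinity>l\<in>- {0..<int N}. cmod (u (int i - l))) \<le> (\<Sum>\<^sub>\<infinity>l. cmod (u (int i - l)))"
      using u by (intro infsum_mono2 abs_summable_on_int_subset) auto
    also have "\<dots> = U"
      unfolding U_def by (rule infsum_int_shift(2))
    finally show ?thesis .
  qed
  have bound: "edge u N \<le> real N * (\<epsilon> / 2) + 2 * real K * U" for N
  proof -
    have "edge u N \<le> (\<Sum>i<N. \<epsilon> / 2 + (if i < K \<or> N \<le> i + K then U else 0))"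
      unfolding edge_def
    proof (rule sum_mono)
      fix i
      show "(\<Sum>\<^sub>\<infinity>l\<in>- {0..<int N}. cmod (u (int i - l)))
          \<le> \<epsilon> / 2 + (if i < K \<or> N \<le> i + K then U else 0)"
        using tail[of i N] full[of i N] \<epsilon> by auto
    qed
    also have "\<dots> = real N * (\<epsilon> / 2) + (\<Sum>i<N. if i < K \<or> N \<le> i + K then U else 0)"
      by (simp add: sum.distrib)
    also have "(\<Sum>i<N. if i < K \<or> N \<le> i + K then U else 0) = real (card {i. i < N \<and> (i < K \<or> N \<le> i + K)}) * U"
      by (subst sum.inter_filter[symmetric]) auto
    also have "\<dots> \<le> real (2 * K) * U"
    proof (intro mult_right_mono of_nat_mono)
      have "card {i. i < N \<and> (i < K \<or> N \<le> i + K)} \<le> card ({..<K} \<union> {N - K..<N})"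
        by (intro card_mono) auto
      also have "\<dots> \<le> K + (N - (N - K))" by (intro order.trans[OF card_Un_le]) simp
      finally show "card {i. i < N \<and> (i < K \<or> N \<le> i + K)} \<le> 2 * K" by linarith
    qed (use U0 in auto)
    finally show ?thesis by simp
  qed
  \<comment> \<open>Beyond this size the boundary rows, costing at most \<open>2 * K * U\<close>
    together, use less than the second half of \<open>N * \<epsilon>\<close>.\<close>
  obtain N0 :: nat where N0: "real N0 > 4 * real K * U / \<epsilon>"
    using reals_Archimedean2 by blast
  show "\<exists>no. \<forall>n\<ge>no. norm (edge u n / real n - 0) < \<epsilon>"
  proof (intro exI allI impI)
    fix n assume n: "n \<ge> Suc N0"
    hence "real n > 4 * real K * U / \<epsilon>" using N0 by linarith
    hence "2 * real K * U < real n * (\<epsilon> / 2)" using \<epsilon> by (simp add: field_simps)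
    with bound[of n] have "edge u n < real n * \<epsilon>" by (simp add: field_simps)
    thus "norm (edge u n / real n - 0) < \<epsilon>"
      using n edge_nonneg[of u n] by (simp add: field_simps)
  qed
qed

text \<open>Substituting \<open>m = i - l\<close> shows that the convolution at \<open>i - j\<close>
  is the \<open>(i, j)\<close> entry of the product of the two bi-infinite Toeplitz matrices. The
  finite product keeps the intermediate indices \<open>l\<close> below \<open>N\<close>, so the
  error is the sum over the others.\<close>

lemma iconv_split:
  assumes u: "u abs_summable_on UNIV" and v: "v abs_summable_on UNIV"
  shows "cmod ((\<Sum>l<N. u (int i - int l) * v (int l - int j)) - iconv u v (int i - int j))
     \<le> (\<Sum>\<^sub>\<infinity>l\<in>- {0..<int N}. cmod (u (int i - l)) * cmod (v (l - int j)))"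
    and "(\<lambda>l. cmod (u (int i - l)) * cmod (v (l - int j))) summable_on UNIV"
proof -
  define F where "F l = u (int i - l) * v (l - int j)" for l
  define V where "V = (\<Sum>\<^sub>\<infinity>n. cmod (v n))"
  have V: "cmod (v n) \<le> V" for n
    using finite_sum_le_infsum[OF v, of "{n}"] unfolding V_def by auto
  have sF: "F abs_summable_on UNIV"
  proof (rule Infinite_Sum.abs_summable_on_comparison_test')
    show "(\<lambda>l. cmod (u (int i - l)) * V) summable_on UNIV"
      using u by (intro summable_on_cmult_left) simp
  qed (auto simp: F_def norm_mult intro!: mult_left_mono V)
  thus "(\<lambda>l. cmod (u (int i - l)) * cmod (v (l - int j))) summable_on UNIV"
    by (simp add: F_def norm_mult)
  have "iconv u v (int i - int j) = (\<Sum>\<^sub>\<infinity>l. F l)"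
    unfolding iconv_def F_def
    by (subst infsum_int_shift(2)[of "\<lambda>m. u m * v (int i - int j - m)" "int i", symmetric])
       (simp add: algebra_simps)
  also have "\<dots> = (\<Sum>\<^sub>\<infinity>l\<in>{0..<int N}. F l) + (\<Sum>\<^sub>\<infinity>l\<in>- {0..<int N}. F l)"
    by (rule infsum_compl_split[OF Infinite_Sum.abs_summable_summable[OF sF]])
  also have "(\<Sum>\<^sub>\<infinity>l\<in>{0..<int N}. F l) = (\<Sum>l<N. F (int l))"
    by (simp, rule sum.reindex_bij_witness[of _ int nat]) auto
  finally have "cmod ((\<Sum>l<N. u (int i - int l) * v (int l - int j)) - iconv u v (int i - int j))
     = cmod (\<Sum>\<^sub>\<infinity>l\<in>- {0..<int N}. F l)"
    by (simp add: F_def norm_minus_commute)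
  also have "\<dots> \<le> (\<Sum>\<^sub>\<infinity>l\<in>- {0..<int N}. cmod (F l))"
    using summable_on_subset_banach[OF sF] by (intro norm_infsum_bound) auto
  finally show "cmod ((\<Sum>l<N. u (int i - int l) * v (int l - int j)) - iconv u v (int i - int j))
     \<le> (\<Sum>\<^sub>\<infinity>l\<in>- {0..<int N}. cmod (u (int i - l)) * cmod (v (l - int j)))"
    by (simp add: F_def norm_mult)
qed

text \<open>Summing over the columns \<open>j\<close> first costs one full mass of \<open>v\<close>
  for each discarded intermediate index; what is left of \<open>u\<close> is exactly its
  \<open>edge\<close>.\<close>

lemma iconv_toeplitz_error:
  assumes u: "u abs_summable_on UNIV" and v: "v abs_summable_on UNIV"
  shows "(\<Sum>i<N. \<Sum>j<N. cmod ((\<Sum>l<N. u (int i - int l) * v (int l - int j)) - iconv u v (int i - int j)))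
     \<le> edge u N * (\<Sum>\<^sub>\<infinity>n. cmod (v n))"
proof -
  define V where "V = (\<Sum>\<^sub>\<infinity>n. cmod (v n))"
  let ?C = "- {0..<int N}"
  have "(\<Sum>i<N. \<Sum>j<N. cmod ((\<Sum>l<N. u (int i - int l) * v (int l - int j)) - iconv u v (int i - int j)))
      \<le> (\<Sum>i<N. \<Sum>j<N. \<Sum>\<^sub>\<infinity>l\<in>?C. cmod (u (int i - l)) * cmod (v (l - int j)))"
    by (intro sum_mono iconv_split(1) u v)
  also have "\<dots> \<le> (\<Sum>i<N. (\<Sum>\<^sub>\<infinity>l\<in>?C. cmod (u (int i - l))) * V)"
  proof (rule sum_mono)
    fix i
    have hs: "((\<lambda>l. \<Sum>j<N. cmod (u (int i - l)) * cmod (v (l - int j)))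
       has_sum (\<Sum>j<N. \<Sum>\<^sub>\<infinity>l\<in>?C. cmod (u (int i - l)) * cmod (v (l - int j)))) ?C"
      by (intro has_sum_sum has_sum_infsum summable_on_subset_banach[OF iconv_split(2)[OF u v]]) auto
    show "(\<Sum>j<N. \<Sum>\<^sub>\<infinity>l\<in>?C. cmod (u (int i - l)) * cmod (v (l - int j)))
        \<le> (\<Sum>\<^sub>\<infinity>l\<in>?C. cmod (u (int i - l))) * V"
    proof (rule has_sum_mono[OF hs])
      show "((\<lambda>l. cmod (u (int i - l)) * V) has_sum (\<Sum>\<^sub>\<infinity>l\<in>?C. cmod (u (int i - l))) * V) ?C"
        by (intro has_sum_cmult_left has_sum_infsum abs_summable_on_int_subset u)
      fix l
      have "(\<Sum>j<N. cmod (v (l - int j))) = (\<Sum>n\<in>(\<lambda>j. l - int j) ` {..<N}. cmod (v n))"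
        by (subst sum.reindex) (auto simp: inj_on_def)
      also have "\<dots> \<le> V" unfolding V_def using v by (intro finite_sum_le_infsum) auto
      finally show "(\<Sum>j<N. cmod (u (int i - l)) * cmod (v (l - int j))) \<le> cmod (u (int i - l)) * V"
        by (simp add: mult_left_mono flip: sum_distrib_left)
    qed
  qed
  also have "\<dots> = edge u N * V" by (simp add: edge_def sum_distrib_right)
  finally show ?thesis by (simp add: V_def)
qed

text \<open>Each row sum is the full series minus a part outside the section, so the error is at
  most \<open>edge u N / N\<close>. It exhibits the symbol as a limit of normalised quadratic forms
  of sections, which carries positivity over to the symbol.\<close>

lemma fourier_cesaro:
  assumes u: "u abs_summable_on UNIV"
  shows "(\<lambda>N. (\<Sum>i<N. \<Sum>j<N. u (int i - int j) * fchar x (int i - int j)) / of_nat N)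
           \<longlonglongrightarrow> (\<Sum>\<^sub>\<infinity>n. u n * fchar x n)"
proof -
  define w where "w n = u n * fchar x n" for n
  have w: "w abs_summable_on UNIV" using u by (simp add: w_def norm_mult)
  have edge_eq: "edge w N = edge u N" for N by (simp add: edge_def w_def norm_mult)
  have row: "cmod ((\<Sum>j<N. w (int i - int j)) - infsum w UNIV)
      \<le> (\<Sum>\<^sub>\<infinity>l\<in>- {0..<int N}. cmod (w (int i - l)))" for i N
  proof -
    have s: "(\<lambda>l. w (int i - l)) abs_summable_on UNIV" using w by simp
    have "infsum w UNIV = (\<Sum>\<^sub>\<infinity>l. w (int i - l))" by (simp only: infsum_int_shift(2))
    also have "\<dots> = (\<Sum>\<^sub>\<infinity>l\<in>{0..<int N}. w (int i - l)) + (\<Sum>\<^sub>\<infinity>l\<in>- {0..<int N}. w (int i - l))"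
      by (rule infsum_compl_split[OF Infinite_Sum.abs_summable_summable[OF s]])
    also have "(\<Sum>\<^sub>\<infinity>l\<in>{0..<int N}. w (int i - l)) = (\<Sum>j<N. w (int i - int j))"
      by (simp, rule sum.reindex_bij_witness[of _ int nat]) auto
    finally have "cmod ((\<Sum>j<N. w (int i - int j)) - infsum w UNIV)
       = cmod (\<Sum>\<^sub>\<infinity>l\<in>- {0..<int N}. w (int i - l))"
      by (simp add: norm_minus_commute)
    also have "\<dots> \<le> (\<Sum>\<^sub>\<infinity>l\<in>- {0..<int N}. cmod (w (int i - l)))"
      by (intro norm_infsum_bound abs_summable_on_int_subset w)
    finally show ?thesis .
  qed
  have "(\<lambda>N. (\<Sum>i<N. \<Sum>j<N. w (int i - int j)) / of_nat N - infsum w UNIV) \<longlonglongrightarrow> 0"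
  proof (rule Lim_null_comparison[OF _ edge_o[OF u]], rule eventually_sequentiallyI[of 1])
    fix N :: nat assume N: "1 \<le> N"
    have "(\<Sum>i<N. \<Sum>j<N. w (int i - int j)) / of_nat N - infsum w UNIV
        = (\<Sum>i<N. (\<Sum>j<N. w (int i - int j)) - infsum w UNIV) / of_nat N"
      using N by (simp add: sum_subtractf diff_divide_distrib)
    also have "cmod \<dots> \<le> edge w N / real N"
      unfolding norm_divide norm_of_nat edge_def
      by (intro divide_right_mono order.trans[OF norm_sum] sum_mono row) auto
    finally show "cmod ((\<Sum>i<N. \<Sum>j<N. w (int i - int j)) / of_nat N - infsum w UNIV)
        \<le> edge u N / real N" by (simp add: edge_eq)
  qed
  thus ?thesis unfolding w_def by (simp add: LIM_zero_iff)
qed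

subsection \<open>Block Toeplitz matrices\<close>

definition edist :: "nat \<Rightarrow> complex mat \<Rightarrow> complex mat \<Rightarrow> real" where
  "edist n X Y = (\<Sum>i<n. \<Sum>j<n. cmod (X $$ (i, j) - Y $$ (i, j)))"

lemma edist_nonneg: "edist n X Y \<ge> 0"
  by (simp add: edist_def sum_nonneg)

lemma edist_triangle: "edist n X Z \<le> edist n X Y + edist n Y Z"
  unfolding edist_def sum.distrib[symmetric]
proof (intro sum_mono)
  fix i j
  show "cmod (X $$ (i, j) - Z $$ (i, j))
      \<le> cmod (X $$ (i, j) - Y $$ (i, j)) + cmod (Y $$ (i, j) - Z $$ (i, j))"
    using norm_triangle_ineq[of "X $$ (i, j) - Y $$ (i, j)" "Y $$ (i, j) - Z $$ (i, j)"] by simp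
qed

text \<open>A factor on the right enters this norm through its largest row sum, a factor on the left
  (next lemma) through its largest column sum. Both stay bounded for Toeplitz sections as
  \<open>N\<close> grows, so an error of size o(N) survives multiplication.\<close>

lemma edist_mult_right:
  assumes "X \<in> carrier_mat n n" "Y \<in> carrier_mat n n" "M \<in> carrier_mat n n"
    and R: "\<And>i. i < n \<Longrightarrow> (\<Sum>j<n. cmod (M $$ (i, j))) \<le> R"
  shows "edist n (X * M) (Y * M) \<le> edist n X Y * R"
proof -
  have "edist n (X * M) (Y * M) \<le> (\<Sum>i<n. \<Sum>j<n. \<Sum>k<n. cmod (X $$ (i, k) - Y $$ (i, k)) * cmod (M $$ (k, j)))"
    unfolding edist_def
  proof (intro sum_mono)
    fix i j assume "i \<in> {..<n}" "j \<in> {..<n}"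
    hence "(X * M) $$ (i, j) - (Y * M) $$ (i, j) = (\<Sum>k<n. (X $$ (i, k) - Y $$ (i, k)) * M $$ (k, j))"
      using assms by (simp add: index_mult_mat_lessThan[of _ n n _ n] sum_subtractf left_diff_distrib del: index_mult_mat)
    also have "cmod \<dots> \<le> (\<Sum>k<n. cmod (X $$ (i, k) - Y $$ (i, k)) * cmod (M $$ (k, j)))"
      by (intro order.trans[OF norm_sum]) (simp add: norm_mult)
    finally show "cmod ((X * M) $$ (i, j) - (Y * M) $$ (i, j)) \<le> \<dots>" .
  qed
  also have "\<dots> = (\<Sum>i<n. \<Sum>k<n. cmod (X $$ (i, k) - Y $$ (i, k)) * (\<Sum>j<n. cmod (M $$ (k, j))))"
    unfolding sum_distrib_left by (rule sum.cong[OF refl]) (rule sum.swap)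
  also have "\<dots> \<le> (\<Sum>i<n. \<Sum>k<n. cmod (X $$ (i, k) - Y $$ (i, k)) * R)"
    by (intro sum_mono mult_left_mono R) auto
  also have "\<dots> = edist n X Y * R" by (simp add: edist_def sum_distrib_right)
  finally show ?thesis .
qed

lemma edist_mult_left:
  assumes "X \<in> carrier_mat n n" "Y \<in> carrier_mat n n" "M \<in> carrier_mat n n"
    and C: "\<And>j. j < n \<Longrightarrow> (\<Sum>i<n. cmod (M $$ (i, j))) \<le> C"
  shows "edist n (M * X) (M * Y) \<le> C * edist n X Y"
proof -
  have "edist n (M * X) (M * Y) \<le> (\<Sum>i<n. \<Sum>j<n. \<Sum>k<n. cmod (M $$ (i, k)) * cmod (X $$ (k, j) - Y $$ (k, j)))"
    unfolding edist_def
  proof (intro sum_mono)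
    fix i j assume "i \<in> {..<n}" "j \<in> {..<n}"
    hence "(M * X) $$ (i, j) - (M * Y) $$ (i, j) = (\<Sum>k<n. M $$ (i, k) * (X $$ (k, j) - Y $$ (k, j)))"
      using assms by (simp add: index_mult_mat_lessThan[of _ n n _ n] sum_subtractf right_diff_distrib del: index_mult_mat)
    also have "cmod \<dots> \<le> (\<Sum>k<n. cmod (M $$ (i, k)) * cmod (X $$ (k, j) - Y $$ (k, j)))"
      by (intro order.trans[OF norm_sum]) (simp add: norm_mult)
    finally show "cmod ((M * X) $$ (i, j) - (M * Y) $$ (i, j)) \<le> \<dots>" .
  qed
  also have "\<dots> = (\<Sum>j<n. \<Sum>k<n. \<Sum>i<n. cmod (M $$ (i, k)) * cmod (X $$ (k, j) - Y $$ (k, j)))"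
    by (rule trans[OF sum.swap], rule sum.cong[OF refl]) (rule sum.swap)
  also have "\<dots> = (\<Sum>j<n. \<Sum>k<n. (\<Sum>i<n. cmod (M $$ (i, k))) * cmod (X $$ (k, j) - Y $$ (k, j)))"
    by (simp add: sum_distrib_right)
  also have "\<dots> \<le> (\<Sum>j<n. \<Sum>k<n. C * cmod (X $$ (k, j) - Y $$ (k, j)))"
    by (intro sum_mono mult_right_mono C) auto
  also have "\<dots> = (\<Sum>k<n. \<Sum>j<n. C * cmod (X $$ (k, j) - Y $$ (k, j)))"
    by (rule sum.swap)
  also have "\<dots> = C * edist n X Y" by (simp add: edist_def sum_distrib_left)
  finally show ?thesis .
qed

lemma row_sum_mult_le:
  assumes "X \<in> carrier_mat n n" "Y \<in> carrier_mat n n" "R \<ge> 0"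
    and Y: "\<And>i. i < n \<Longrightarrow> (\<Sum>j<n. cmod (Y $$ (i, j))) \<le> R"
    and X: "\<And>i. i < n \<Longrightarrow> (\<Sum>j<n. cmod (X $$ (i, j))) \<le> Q" and i: "i < n"
  shows "(\<Sum>j<n. cmod ((X * Y) $$ (i, j))) \<le> Q * R"
proof -
  have "(\<Sum>j<n. cmod ((X * Y) $$ (i, j))) \<le> (\<Sum>j<n. \<Sum>k<n. cmod (X $$ (i, k)) * cmod (Y $$ (k, j)))"
  proof (rule sum_mono)
    fix j assume "j \<in> {..<n}"
    hence "(X * Y) $$ (i, j) = (\<Sum>k<n. X $$ (i, k) * Y $$ (k, j))"
      using assms by (intro index_mult_mat_lessThan) auto
    thus "cmod ((X * Y) $$ (i, j)) \<le> (\<Sum>k<n. cmod (X $$ (i, k)) * cmod (Y $$ (k, j)))"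
      by (simp only:) (intro order.trans[OF norm_sum], simp add: norm_mult)
  qed
  also have "\<dots> = (\<Sum>k<n. cmod (X $$ (i, k)) * (\<Sum>j<n. cmod (Y $$ (k, j))))"
    by (subst sum.swap) (simp add: sum_distrib_left)
  also have "\<dots> \<le> (\<Sum>k<n. cmod (X $$ (i, k)) * R)"
    by (intro sum_mono mult_left_mono Y) auto
  also have "\<dots> \<le> Q * R"
    unfolding sum_distrib_right[symmetric] by (intro mult_right_mono X i assms)
  finally show ?thesis .
qed

lemma mtrace_edist:
  assumes "X \<in> carrier_mat n n" "Y \<in> carrier_mat n n"
  shows "cmod (mtrace X - mtrace Y) \<le> edist n X Y"
proof -
  have "cmod (mtrace X - mtrace Y) \<le> (\<Sum>i<n. cmod (X $$ (i, i) - Y $$ (i, i)))"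
    using assms by (auto simp: mtrace_def norm_sum simp flip: sum_subtractf)
  also have "\<dots> \<le> edist n X Y"
    unfolding edist_def by (intro sum_mono member_le_sum) auto
  finally show ?thesis .
qed

text \<open>\<open>a \<alpha> \<beta> n\<close> is the \<open>n\<close>-th Fourier coefficient of
  the \<open>(\<alpha>, \<beta>)\<close> entry of a matrix-valued symbol.\<close>

type_synonym bseq = "nat \<Rightarrow> nat \<Rightarrow> int \<Rightarrow> complex"

definition bsummable :: "nat \<Rightarrow> bseq \<Rightarrow> bool" where
  "bsummable d a \<longleftrightarrow> (\<forall>\<alpha><d. \<forall>\<beta><d. a \<alpha> \<beta> abs_summable_on UNIV)"

text \<open>The block index is the outer one: a \<open>d\<close> by \<open>d\<close> array of
  \<open>N\<close> by \<open>N\<close> Toeplitz blocks rather than an \<open>N\<close> by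
  \<open>N\<close> array of small ones. This is the layout of \<open>four_block_mat\<close> in
  \<open>Gtilde\<close> and \<open>Rtilde\<close>.\<close>

definition btoep :: "nat \<Rightarrow> nat \<Rightarrow> bseq \<Rightarrow> complex mat" where
  "btoep d N a = mat (d * N) (d * N)
     (\<lambda>(i, j). a (i div N) (j div N) (int (i mod N) - int (j mod N)))"

definition bsymb :: "nat \<Rightarrow> bseq \<Rightarrow> real \<Rightarrow> complex mat" where
  "bsymb d a x = mat d d (\<lambda>(\<alpha>, \<beta>). \<Sum>\<^sub>\<infinity>n. a \<alpha> \<beta> n * fchar x n)"

definition bconv :: "nat \<Rightarrow> bseq \<Rightarrow> bseq \<Rightarrow> bseq" where
  "bconv d a b \<alpha> \<beta> n = (\<Sum>\<gamma><d. iconv (a \<alpha> \<gamma>) (b \<gamma> \<beta>) n)"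

text \<open>Fourier coefficients of the powers of the symbol (\<open>bsymb_bpow\<close>); the new
  factor stands on the right, as in the recursion of matrix powers.\<close>

fun bpow :: "nat \<Rightarrow> bseq \<Rightarrow> nat \<Rightarrow> bseq" where
  "bpow d a 0 = (\<lambda>\<alpha> \<beta> n. if \<alpha> = \<beta> \<and> n = 0 then 1 else 0)"
| "bpow d a (Suc k) = bconv d (bpow d a k) a"

text \<open>One crude bound, independent of \<open>N\<close> and of the frequency, for the row and
  column sums of every section and for the row sums of the symbol. It makes a common spectral
  interval possible.\<close>

definition bnorm :: "nat \<Rightarrow> bseq \<Rightarrow> real" where
  "bnorm d a = (\<Sum>\<alpha><d. \<Sum>\<beta><d. \<Sum>\<^sub>\<infinity>n. cmod (a \<alpha> \<beta> n))"

lemma bnorm_nonneg: "bnorm d a \<ge> 0"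
  unfolding bnorm_def by (intro sum_nonneg infsum_nonneg) auto

lemma btoep_carrier [simp]: "btoep d N a \<in> carrier_mat (d * N) (d * N)"
  by (simp add: btoep_def)

lemma bsymb_carrier [simp]: "bsymb d a x \<in> carrier_mat d d"
  by (simp add: bsymb_def)

lemma sum_blocks:
  fixes f :: "nat \<Rightarrow> nat \<Rightarrow> 'a :: comm_monoid_add"
  shows "(\<Sum>k<d * N. f (k div N) (k mod N)) = (\<Sum>\<gamma><d. \<Sum>l<N. f \<gamma> l)"
proof -
  have lt: "\<gamma> * N + l < d * N" if "\<gamma> < d" "l < N" for \<gamma> l
  proof -
    have "\<gamma> * N + l < Suc \<gamma> * N" using that by simp
    also have "\<dots> \<le> d * N" using that by (intro mult_le_mono1) simp
    finally show ?thesis .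
  qed
  have "(\<Sum>k<d * N. f (k div N) (k mod N)) = (\<Sum>(\<gamma>, l)\<in>{..<d} \<times> {..<N}. f \<gamma> l)"
    by (rule sum.reindex_bij_witness[of _ "\<lambda>(\<gamma>, l). \<gamma> * N + l" "\<lambda>k. (k div N, k mod N)"])
       (auto simp: less_mult_imp_div_less lt intro!: mod_less_divisor gr0I)
  thus ?thesis by (simp add: sum.cartesian_product)
qed

lemma block_index_bounds:
  fixes i d N :: nat
  assumes "i < d * N"
  shows "i div N < d" "i mod N < N"
  using assms by (auto simp: less_mult_imp_div_less intro!: mod_less_divisor gr0I)

lemma btoep_index:
  "i < d * N \<Longrightarrow> j < d * N \<Longrightarrow>
     btoep d N a $$ (i, j) = a (i div N) (j div N) (int (i mod N) - int (j mod N))"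
  by (simp add: btoep_def)

lemma sum_int_le_infsum:
  fixes u :: "int \<Rightarrow> complex"
  assumes "u abs_summable_on UNIV"
  shows "(\<Sum>l<N. cmod (u (k - int l))) \<le> (\<Sum>\<^sub>\<infinity>n. cmod (u n))"
    and "(\<Sum>l<N. cmod (u (int l - k))) \<le> (\<Sum>\<^sub>\<infinity>n. cmod (u n))"
proof -
  have "(\<Sum>l<N. cmod (u (k - int l))) = (\<Sum>n\<in>(\<lambda>l. k - int l) ` {..<N}. cmod (u n))"
    by (subst sum.reindex) (auto simp: inj_on_def)
  also have "\<dots> \<le> (\<Sum>\<^sub>\<infinity>n. cmod (u n))" using assms by (intro finite_sum_le_infsum) auto
  finally show "(\<Sum>l<N. cmod (u (k - int l))) \<le> (\<Sum>\<^sub>\<infinity>n. cmod (u n))" .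
  have "(\<Sum>l<N. cmod (u (int l - k))) = (\<Sum>n\<in>(\<lambda>l. int l - k) ` {..<N}. cmod (u n))"
    by (subst sum.reindex) (auto simp: inj_on_def)
  also have "\<dots> \<le> (\<Sum>\<^sub>\<infinity>n. cmod (u n))" using assms by (intro finite_sum_le_infsum) auto
  finally show "(\<Sum>l<N. cmod (u (int l - k))) \<le> (\<Sum>\<^sub>\<infinity>n. cmod (u n))" .
qed

lemma btoep_row_sum:
  assumes a: "bsummable d a" and i: "i < d * N"
  shows "(\<Sum>j<d * N. cmod (btoep d N a $$ (i, j))) \<le> bnorm d a"
proof -
  let ?\<alpha> = "i div N"
  have \<alpha>: "?\<alpha> < d" using block_index_bounds[OF i] by simp
  have "(\<Sum>j<d * N. cmod (btoep d N a $$ (i, j)))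
     = (\<Sum>\<beta><d. \<Sum>l<N. cmod (a ?\<alpha> \<beta> (int (i mod N) - int l)))"
    using i by (simp add: btoep_index sum_blocks[of "\<lambda>\<beta> l. cmod (a ?\<alpha> \<beta> (int (i mod N) - int l))"])
  also have "\<dots> \<le> (\<Sum>\<beta><d. \<Sum>\<^sub>\<infinity>n. cmod (a ?\<alpha> \<beta> n))"
    using a \<alpha> by (intro sum_mono sum_int_le_infsum) (auto simp: bsummable_def)
  also have "\<dots> \<le> bnorm d a"
    unfolding bnorm_def using \<alpha>
    by (intro member_le_sum[of ?\<alpha> _ "\<lambda>\<alpha>. \<Sum>\<beta><d. \<Sum>\<^sub>\<infinity>n. cmod (a \<alpha> \<beta> n)"] sum_nonneg infsum_nonneg) auto
  finally show ?thesis .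
qed

lemma btoep_col_sum:
  assumes a: "bsummable d a" and j: "j < d * N"
  shows "(\<Sum>i<d * N. cmod (btoep d N a $$ (i, j))) \<le> bnorm d a"
proof -
  let ?\<beta> = "j div N"
  have \<beta>: "?\<beta> < d" using block_index_bounds[OF j] by simp
  have "(\<Sum>i<d * N. cmod (btoep d N a $$ (i, j)))
     = (\<Sum>\<alpha><d. \<Sum>l<N. cmod (a \<alpha> ?\<beta> (int l - int (j mod N))))"
    using j by (simp add: btoep_index sum_blocks[of "\<lambda>\<alpha> l. cmod (a \<alpha> ?\<beta> (int l - int (j mod N)))"])
  also have "\<dots> \<le> (\<Sum>\<alpha><d. \<Sum>\<^sub>\<infinity>n. cmod (a \<alpha> ?\<beta> n))"
    using a \<beta> by (intro sum_mono sum_int_le_infsum) (auto simp: bsummable_def)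
  also have "\<dots> \<le> bnorm d a"
    unfolding bnorm_def using \<beta>
    by (intro sum_mono member_le_sum[of ?\<beta> _ "\<lambda>\<beta>. \<Sum>\<^sub>\<infinity>n. cmod (a _ \<beta> n)"] infsum_nonneg) auto
  finally show ?thesis .
qed

lemma bsymb_row_sum:
  assumes a: "bsummable d a" and \<alpha>: "\<alpha> < d"
  shows "(\<Sum>\<beta><d. cmod (bsymb d a x $$ (\<alpha>, \<beta>))) \<le> bnorm d a"
proof -
  have "(\<Sum>\<beta><d. cmod (bsymb d a x $$ (\<alpha>, \<beta>))) \<le> (\<Sum>\<beta><d. \<Sum>\<^sub>\<infinity>n. cmod (a \<alpha> \<beta> n))"
  proof (rule sum_mono)
    fix \<beta> assume "\<beta> \<in> {..<d}"
    hence "(\<lambda>n. a \<alpha> \<beta> n * fchar x n) abs_summable_on UNIV"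
      using a \<alpha> by (auto simp: bsummable_def norm_mult)
    from norm_infsum_bound[OF this] show "cmod (bsymb d a x $$ (\<alpha>, \<beta>)) \<le> (\<Sum>\<^sub>\<infinity>n. cmod (a \<alpha> \<beta> n))"
      using \<alpha> \<open>\<beta> \<in> {..<d}\<close> by (simp add: bsymb_def norm_mult)
  qed
  also have "\<dots> \<le> bnorm d a"
    unfolding bnorm_def using \<alpha>
    by (intro member_le_sum[of \<alpha> _ "\<lambda>\<alpha>. \<Sum>\<beta><d. \<Sum>\<^sub>\<infinity>n. cmod (a \<alpha> \<beta> n)"] sum_nonneg infsum_nonneg) auto
  finally show ?thesis .
qed

lemma bsummable_bconv:
  assumes "bsummable d a" "bsummable d b"
  shows "bsummable d (bconv d a b)"
  unfolding bsummable_def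
proof (intro allI impI)
  fix \<alpha> \<beta> assume "\<alpha> < d" "\<beta> < d"
  hence s: "iconv (a \<alpha> \<gamma>) (b \<gamma> \<beta>) abs_summable_on UNIV" if "\<gamma> < d" for \<gamma>
    using assms that by (intro iconv_abs_summable) (auto simp: bsummable_def)
  have "(\<lambda>n. \<Sum>\<gamma><d. cmod (iconv (a \<alpha> \<gamma>) (b \<gamma> \<beta>) n)) summable_on UNIV"
    by (rule has_sum_imp_summable, rule has_sum_sum, simp, rule has_sum_infsum, rule s, simp)
  thus "bconv d a b \<alpha> \<beta> abs_summable_on UNIV"
    by (rule Infinite_Sum.abs_summable_on_comparison_test') (simp add: bconv_def norm_sum)
qed

lemma bsymb_bconv:
  assumes "bsummable d a" "bsummable d b"
  shows "bsymb d (bconv d a b) x = bsymb d a x * bsymb d b x"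
proof (rule eq_matI)
  fix \<alpha> \<beta> assume "\<alpha> < dim_row (bsymb d a x * bsymb d b x)" "\<beta> < dim_col (bsymb d a x * bsymb d b x)"
  hence ab: "\<alpha> < d" "\<beta> < d" by (simp_all add: bsymb_def)
  have s: "(\<lambda>n. iconv (a \<alpha> \<gamma>) (b \<gamma> \<beta>) n * fchar x n) summable_on UNIV" if "\<gamma> < d" for \<gamma>
    by (rule Infinite_Sum.abs_summable_summable)
       (use assms that ab iconv_abs_summable[of "a \<alpha> \<gamma>" "b \<gamma> \<beta>"] in \<open>auto simp: bsummable_def norm_mult\<close>)
  have "((\<lambda>n. \<Sum>\<gamma><d. iconv (a \<alpha> \<gamma>) (b \<gamma> \<beta>) n * fchar x n) has_sum
      (\<Sum>\<gamma><d. \<Sum>\<^sub>\<infinity>n. iconv (a \<alpha> \<gamma>) (b \<gamma> \<beta>) n * fchar x n)) UNIV"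
    by (rule has_sum_sum, simp, rule has_sum_infsum, rule s, simp)
  hence "(\<Sum>\<^sub>\<infinity>n. bconv d a b \<alpha> \<beta> n * fchar x n)
      = (\<Sum>\<gamma><d. \<Sum>\<^sub>\<infinity>n. iconv (a \<alpha> \<gamma>) (b \<gamma> \<beta>) n * fchar x n)"
    by (simp add: bconv_def sum_distrib_right infsumI)
  also have "\<dots> = (\<Sum>\<gamma><d. (\<Sum>\<^sub>\<infinity>n. a \<alpha> \<gamma> n * fchar x n) * (\<Sum>\<^sub>\<infinity>n. b \<gamma> \<beta> n * fchar x n))"
    using assms ab by (intro sum.cong iconv_fourier) (auto simp: bsummable_def)
  also have "\<dots> = (bsymb d a x * bsymb d b x) $$ (\<alpha>, \<beta>)"
    using ab by (subst index_mult_mat_lessThan[of _ d d _ d]) (auto simp: bsymb_def)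
  finally show "bsymb d (bconv d a b) x $$ (\<alpha>, \<beta>) = (bsymb d a x * bsymb d b x) $$ (\<alpha>, \<beta>)"
    using ab by (simp add: bsymb_def)
qed (auto simp: bsymb_def)

lemma has_sum_delta_int: "((\<lambda>n::int. if n = 0 then c else 0) has_sum (c :: 'a :: real_normed_vector)) UNIV"
  by (rule has_sum_finite_neutralI[of "{0}"]) auto

lemma bsummable_bpow:
  assumes "bsummable d a"
  shows "bsummable d (bpow d a k)"
proof (induction k)
  case 0
  have "(\<lambda>n::int. cmod (if \<alpha> = \<beta> \<and> n = 0 then 1 else 0)) summable_on UNIV" for \<alpha> \<beta> :: nat
    by (rule finite_nonzero_values_imp_summable_on, rule finite_subset[of _ "{0}"]) auto
  thus ?case by (simp add: bsummable_def)
qed (use assms in \<open>auto intro: bsummable_bconv\<close>)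

lemma bsymb_bpow:
  assumes "bsummable d a"
  shows "bsymb d (bpow d a k) x = bsymb d a x ^\<^sub>m k"
proof (induction k)
  case 0
  have "(\<Sum>\<^sub>\<infinity>n. (if \<alpha> = \<beta> \<and> n = 0 then 1 else 0) * fchar x n) = (if \<alpha> = \<beta> then 1 else 0)"
    for \<alpha> \<beta> :: nat
  proof -
    have "(\<Sum>\<^sub>\<infinity>n. (if \<alpha> = \<beta> \<and> n = 0 then 1 else 0) * fchar x n)
        = (\<Sum>\<^sub>\<infinity>n::int. if n = 0 then (if \<alpha> = \<beta> then 1 else 0) else 0)"
      by (intro infsum_cong) auto
    also have "\<dots> = (if \<alpha> = \<beta> then 1 else 0)" by (rule infsumI[OF has_sum_delta_int])
    finally show ?thesis .
  qed
  thus ?case by (intro eq_matI) (auto simp: bsymb_def)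
next
  case (Suc k)
  thus ?case using assms by (simp add: bsymb_bconv bsummable_bpow)
qed

text \<open>A block of the product is a sum, over the intermediate block index, of products of
  scalar Toeplitz sections. The error thus splits into a fixed number of scalar errors, each at most
  a constant times an \<open>edge\<close>.\<close>

lemma btoep_mult_error:
  assumes a: "bsummable d a" and b: "bsummable d b"
  shows "(\<lambda>N. edist (d * N) (btoep d N a * btoep d N b) (btoep d N (bconv d a b)) / real N) \<longlonglongrightarrow> 0"
proof -
  define E where "E N = (\<Sum>\<alpha><d. \<Sum>\<beta><d. \<Sum>\<gamma><d. edge (a \<alpha> \<gamma>) N * (\<Sum>\<^sub>\<infinity>n. cmod (b \<gamma> \<beta> n)))" for N
  have le: "edist (d * N) (btoep d N a * btoep d N b) (btoep d N (bconv d a b)) \<le> E N" for N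
  proof -
    define e where "e \<alpha> \<beta> \<gamma> i j = cmod ((\<Sum>l<N. a \<alpha> \<gamma> (int i - int l) * b \<gamma> \<beta> (int l - int j))
       - iconv (a \<alpha> \<gamma>) (b \<gamma> \<beta>) (int i - int j))" for \<alpha> \<beta> \<gamma> i j
    have "edist (d * N) (btoep d N a * btoep d N b) (btoep d N (bconv d a b))
       \<le> (\<Sum>i<d * N. \<Sum>j<d * N. \<Sum>\<gamma><d. e (i div N) (j div N) \<gamma> (i mod N) (j mod N))"
      unfolding edist_def
    proof (intro sum_mono)
      fix i j assume "i \<in> {..<d * N}" "j \<in> {..<d * N}"
      hence i: "i < d * N" and j: "j < d * N" by auto
      have "(btoep d N a * btoep d N b) $$ (i, j)
         = (\<Sum>k<d * N. btoep d N a $$ (i, k) * btoep d N b $$ (k, j))"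
        using i j by (intro index_mult_mat_lessThan) auto
      also have "\<dots> = (\<Sum>\<gamma><d. \<Sum>l<N. a (i div N) \<gamma> (int (i mod N) - int l) * b \<gamma> (j div N) (int l - int (j mod N)))"
        using i j by (simp add: btoep_index
          sum_blocks[of "\<lambda>\<gamma> l. a (i div N) \<gamma> (int (i mod N) - int l) * b \<gamma> (j div N) (int l - int (j mod N))"])
      finally have "(btoep d N a * btoep d N b) $$ (i, j) - btoep d N (bconv d a b) $$ (i, j)
         = (\<Sum>\<gamma><d. (\<Sum>l<N. a (i div N) \<gamma> (int (i mod N) - int l) * b \<gamma> (j div N) (int l - int (j mod N)))
              - iconv (a (i div N) \<gamma>) (b \<gamma> (j div N)) (int (i mod N) - int (j mod N)))"
        using i j by (simp only: btoep_index bconv_def sum_subtractf)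
      thus "cmod ((btoep d N a * btoep d N b) $$ (i, j) - btoep d N (bconv d a b) $$ (i, j))
          \<le> (\<Sum>\<gamma><d. e (i div N) (j div N) \<gamma> (i mod N) (j mod N))"
        unfolding e_def by (simp only: norm_sum)
    qed
    also have "\<dots> = (\<Sum>\<alpha><d. \<Sum>i<N. \<Sum>\<beta><d. \<Sum>j<N. \<Sum>\<gamma><d. e \<alpha> \<beta> \<gamma> i j)"
      by (simp only: sum_blocks[of "\<lambda>\<beta> j. \<Sum>\<gamma><d. e _ \<beta> \<gamma> _ j"]
          sum_blocks[of "\<lambda>\<alpha> i. \<Sum>\<beta><d. \<Sum>j<N. \<Sum>\<gamma><d. e \<alpha> \<beta> \<gamma> i j"])
    also have "\<dots> = (\<Sum>\<alpha><d. \<Sum>\<beta><d. \<Sum>\<gamma><d. \<Sum>i<N. \<Sum>j<N. e \<alpha> \<beta> \<gamma> i j)"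
    proof (rule sum.cong[OF refl])
      fix \<alpha>
      have "(\<Sum>i<N. \<Sum>\<beta><d. \<Sum>j<N. \<Sum>\<gamma><d. e \<alpha> \<beta> \<gamma> i j) = (\<Sum>i<N. \<Sum>\<beta><d. \<Sum>\<gamma><d. \<Sum>j<N. e \<alpha> \<beta> \<gamma> i j)"
        by (intro sum.cong refl sum.swap)
      also have "\<dots> = (\<Sum>\<beta><d. \<Sum>i<N. \<Sum>\<gamma><d. \<Sum>j<N. e \<alpha> \<beta> \<gamma> i j)" by (rule sum.swap)
      also have "\<dots> = (\<Sum>\<beta><d. \<Sum>\<gamma><d. \<Sum>i<N. \<Sum>j<N. e \<alpha> \<beta> \<gamma> i j)" by (intro sum.cong refl sum.swap)
      finally show "(\<Sum>i<N. \<Sum>\<beta><d. \<Sum>j<N. \<Sum>\<gamma><d. e \<alpha> \<beta> \<gamma> i j) = \<dots>" .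
    qed
    also have "\<dots> \<le> E N"
      unfolding E_def e_def using a b
      by (intro sum_mono iconv_toeplitz_error) (auto simp: bsummable_def)
    finally show ?thesis .
  qed
  have "(\<lambda>N. \<Sum>\<alpha><d. \<Sum>\<beta><d. \<Sum>\<gamma><d. edge (a \<alpha> \<gamma>) N / real N * (\<Sum>\<^sub>\<infinity>n. cmod (b \<gamma> \<beta> n)))
      \<longlonglongrightarrow> (\<Sum>\<alpha><d. \<Sum>\<beta><d. \<Sum>\<gamma><d. 0 * (\<Sum>\<^sub>\<infinity>n. cmod (b \<gamma> \<beta> n)))"
    using a by (intro tendsto_intros edge_o) (auto simp: bsummable_def)
  hence E0: "(\<lambda>N. E N / real N) \<longlonglongrightarrow> 0" by (simp add: E_def sum_divide_distrib)
  show ?thesis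
  proof (rule Lim_null_comparison[OF _ E0], intro always_eventually allI)
    fix N
    show "norm (edist (d * N) (btoep d N a * btoep d N b) (btoep d N (bconv d a b)) / real N) \<le> E N / real N"
      using le[of N] edist_nonneg[of "d * N" "btoep d N a * btoep d N b" "btoep d N (bconv d a b)"]
      by (simp add: divide_right_mono)
  qed
qed

text \<open>The induction step passes from \<open>M^(k+1)\<close> through \<open>P * M\<close> and
  \<open>P * btoep d N c\<close>, with \<open>M\<close> the product of the sections and
  \<open>P\<close> the section of the \<open>k\<close>-th power. The old error is multiplied on the
  right by \<open>M\<close>, the error of \<open>M\<close> itself on the left by \<open>P\<close>,
  and the last passage is a fresh truncation error; all multipliers are independent of
  \<open>N\<close>.\<close>

lemma btoep_bpow_error:
  assumes a: "bsummable d a" and b: "bsummable d b"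
  defines "c \<equiv> bconv d a b"
  shows "(\<lambda>N. edist (d * N) ((btoep d N a * btoep d N b) ^\<^sub>m k) (btoep d N (bpow d c k)) / real N) \<longlonglongrightarrow> 0"
proof (induction k)
  case 0
  have "1\<^sub>m (d * N) = btoep d N (bpow d c 0)" for N
  proof (rule eq_matI)
    fix i j assume "i < dim_row (btoep d N (bpow d c 0))" "j < dim_col (btoep d N (bpow d c 0))"
    hence ij: "i < d * N" "j < d * N" by (simp_all add: btoep_def)
    have "i = j \<longleftrightarrow> i div N = j div N \<and> i mod N = j mod N" by (metis div_mult_mod_eq)
    thus "1\<^sub>m (d * N) $$ (i, j) = btoep d N (bpow d c 0) $$ (i, j)"
      using ij by (simp add: btoep_index)
  qed (auto simp: btoep_def)
  hence "edist (d * N) ((btoep d N a * btoep d N b) ^\<^sub>m 0) (btoep d N (bpow d c 0)) = 0" for N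
    by (simp add: edist_def btoep_def)
  thus ?case by simp
next
  case (Suc k)
  have c: "bsummable d c" unfolding c_def by (intro bsummable_bconv a b)
  let ?M = "\<lambda>N. btoep d N a * btoep d N b" and ?P = "\<lambda>N. btoep d N (bpow d c k)"
  have bnd: "edist (d * N) (?M N ^\<^sub>m Suc k) (btoep d N (bpow d c (Suc k))) / real N
     \<le> edist (d * N) (?M N ^\<^sub>m k) (?P N) / real N * (bnorm d a * bnorm d b)
       + bnorm d (bpow d c k) * (edist (d * N) (?M N) (btoep d N c) / real N)
       + edist (d * N) (?P N * btoep d N c) (btoep d N (bpow d c (Suc k))) / real N" for N
  proof -
    have Mc: "?M N \<in> carrier_mat (d * N) (d * N)" by (rule mult_carrier_mat[where n = "d * N"]) simp_all
    have "edist (d * N) (?M N ^\<^sub>m Suc k) (?P N * ?M N)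
        \<le> edist (d * N) (?M N ^\<^sub>m k) (?P N) * (bnorm d a * bnorm d b)"
      unfolding pow_mat.simps using Mc a b
      by (intro edist_mult_right row_sum_mult_le btoep_row_sum bnorm_nonneg) auto
    moreover have "edist (d * N) (?P N * ?M N) (?P N * btoep d N c)
        \<le> bnorm d (bpow d c k) * edist (d * N) (?M N) (btoep d N c)"
      using Mc by (intro edist_mult_left btoep_col_sum bsummable_bpow c) auto
    ultimately have "edist (d * N) (?M N ^\<^sub>m Suc k) (btoep d N (bpow d c (Suc k)))
      \<le> edist (d * N) (?M N ^\<^sub>m k) (?P N) * (bnorm d a * bnorm d b)
       + bnorm d (bpow d c k) * edist (d * N) (?M N) (btoep d N c)
       + edist (d * N) (?P N * btoep d N c) (btoep d N (bpow d c (Suc k)))"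
      using edist_triangle[of "d * N" "?M N ^\<^sub>m Suc k" "btoep d N (bpow d c (Suc k))" "?P N * ?M N"]
        edist_triangle[of "d * N" "?P N * ?M N" "btoep d N (bpow d c (Suc k))" "?P N * btoep d N c"]
      by linarith
    from divide_right_mono[OF this, of "real N"] show ?thesis by (simp add: add_divide_distrib)
  qed
  have "(\<lambda>N. edist (d * N) (?M N ^\<^sub>m k) (?P N) / real N * (bnorm d a * bnorm d b)
       + bnorm d (bpow d c k) * (edist (d * N) (?M N) (btoep d N c) / real N)
       + edist (d * N) (?P N * btoep d N c) (btoep d N (bpow d c (Suc k))) / real N)
     \<longlonglongrightarrow> 0 * (bnorm d a * bnorm d b) + bnorm d (bpow d c k) * 0 + 0"
    unfolding bpow.simps c_def
    by (intro tendsto_intros btoep_mult_error Suc.IH[unfolded c_def] a b bsummable_bpow bsummable_bconv)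
  hence lim: "(\<lambda>N. edist (d * N) (?M N ^\<^sub>m k) (?P N) / real N * (bnorm d a * bnorm d b)
       + bnorm d (bpow d c k) * (edist (d * N) (?M N) (btoep d N c) / real N)
       + edist (d * N) (?P N * btoep d N c) (btoep d N (bpow d c (Suc k))) / real N) \<longlonglongrightarrow> 0"
    by simp
  show ?case
    by (rule Lim_null_comparison[OF _ lim], intro always_eventually allI)
       (use bnd edist_nonneg in \<open>simp add: abs_of_nonneg\<close>)
qed

lemma mtrace_btoep: "mtrace (btoep d N c) = of_nat N * (\<Sum>\<alpha><d. c \<alpha> \<alpha> 0)"
proof -
  have "mtrace (btoep d N c) = (\<Sum>i<d * N. (\<lambda>\<alpha> l. c \<alpha> \<alpha> 0) (i div N) (i mod N))"
    by (auto simp: mtrace_def btoep_index btoep_def intro!: sum.cong)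
  also have "\<dots> = (\<Sum>\<alpha><d. \<Sum>l<N. c \<alpha> \<alpha> 0)" by (rule sum_blocks)
  finally show ?thesis by (simp add: sum_distrib_left)
qed

lemma btoep_moment_limit:
  assumes a: "bsummable d a" and b: "bsummable d b"
  shows "(\<lambda>N. mtrace ((btoep d N a * btoep d N b) ^\<^sub>m k) / of_nat N)
           \<longlonglongrightarrow> (\<Sum>\<alpha><d. bpow d (bconv d a b) k \<alpha> \<alpha> 0)"
proof -
  let ?c = "bpow d (bconv d a b) k"
  have "(\<lambda>N. mtrace ((btoep d N a * btoep d N b) ^\<^sub>m k) / of_nat N - (\<Sum>\<alpha><d. ?c \<alpha> \<alpha> 0)) \<longlonglongrightarrow> 0"
  proof (rule Lim_null_comparison[OF _ btoep_bpow_error[OF a b, of k]], rule eventually_sequentiallyI[of 1])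
    fix N :: nat assume N: "1 \<le> N"
    have "mtrace ((btoep d N a * btoep d N b) ^\<^sub>m k) / of_nat N - (\<Sum>\<alpha><d. ?c \<alpha> \<alpha> 0)
        = (mtrace ((btoep d N a * btoep d N b) ^\<^sub>m k) - mtrace (btoep d N ?c)) / of_nat N"
      using N by (simp add: mtrace_btoep diff_divide_distrib)
    moreover have "btoep d N a * btoep d N b \<in> carrier_mat (d * N) (d * N)"
      by (rule mult_carrier_mat[where n = "d * N"]) simp_all
    hence "cmod (mtrace ((btoep d N a * btoep d N b) ^\<^sub>m k) - mtrace (btoep d N ?c))
        \<le> edist (d * N) ((btoep d N a * btoep d N b) ^\<^sub>m k) (btoep d N ?c)"
      by (intro mtrace_edist) auto
    ultimately show "norm (mtrace ((btoep d N a * btoep d N b) ^\<^sub>m k) / of_nat N - (\<Sum>\<alpha><d. ?c \<alpha> \<alpha> 0))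
        \<le> edist (d * N) ((btoep d N a * btoep d N b) ^\<^sub>m k) (btoep d N ?c) / real N"
      by (simp add: norm_divide divide_right_mono)
  qed
  thus ?thesis by (simp add: LIM_zero_iff)
qed

subsection \<open>The limit theorem for products of positive semidefinite block Toeplitz matrices\<close>

text \<open>Positivity of all finite sections, written on the coefficients with doubly indexed
  vectors. From this one condition come both the positivity of every \<open>btoep\<close> and that
  of the symbol at every frequency.\<close>

definition bpsd :: "nat \<Rightarrow> bseq \<Rightarrow> bool" where
  "bpsd d a \<longleftrightarrow> (\<forall>\<alpha><d. \<forall>\<beta><d. \<forall>n. a \<beta> \<alpha> n = cnj (a \<alpha> \<beta> (- n))) \<and>
     (\<forall>N v. 0 \<le> Re (\<Sum>\<alpha><d. \<Sum>i<N. \<Sum>\<beta><d. \<Sum>j<N. cnj (v \<alpha> i) * a \<alpha> \<beta> (int i - int j) * v \<beta> j))"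

lemma psd_btoep:
  assumes "bpsd d a"
  shows "psd (d * N) (btoep d N a)"
  unfolding psd_def
proof (intro conjI allI impI)
  fix i j assume ij: "i < d * N" "j < d * N"
  hence "a (j div N) (i div N) (int (j mod N) - int (i mod N))
      = cnj (a (i div N) (j div N) (- (int (j mod N) - int (i mod N))))"
    using assms block_index_bounds unfolding bpsd_def by blast
  thus "btoep d N a $$ (j, i) = cnj (btoep d N a $$ (i, j))"
    using ij by (simp add: btoep_index)
next
  fix v :: "nat \<Rightarrow> complex"
  define V where "V \<alpha> i = v (\<alpha> * N + i)" for \<alpha> i
  have v: "v k = V (k div N) (k mod N)" for k by (simp add: V_def)
  have "sesq (d * N) (btoep d N a) v v
     = (\<Sum>k<d * N. \<Sum>l<d * N. cnj (V (k div N) (k mod N)) * a (k div N) (l div N) (int (k mod N) - int (l mod N))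
          * V (l div N) (l mod N))"
    unfolding sesq_def v by (intro sum.cong refl) (simp add: btoep_index)
  also have "\<dots> = (\<Sum>\<alpha><d. \<Sum>i<N. \<Sum>\<beta><d. \<Sum>j<N. cnj (V \<alpha> i) * a \<alpha> \<beta> (int i - int j) * V \<beta> j)"
    by (simp only: sum_blocks[of "\<lambda>\<beta> j. cnj _ * a _ \<beta> (_ - int j) * V \<beta> j"]
         sum_blocks[of "\<lambda>\<alpha> i. \<Sum>\<beta><d. \<Sum>j<N. cnj (V \<alpha> i) * a \<alpha> \<beta> (int i - int j) * V \<beta> j"])
  finally have "sesq (d * N) (btoep d N a) v v
     = (\<Sum>\<alpha><d. \<Sum>i<N. \<Sum>\<beta><d. \<Sum>j<N. cnj (V \<alpha> i) * a \<alpha> \<beta> (int i - int j) * V \<beta> j)" .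
  moreover have "0 \<le> Re (\<Sum>\<alpha><d. \<Sum>i<N. \<Sum>\<beta><d. \<Sum>j<N. cnj (V \<alpha> i) * a \<alpha> \<beta> (int i - int j) * V \<beta> j)"
    using assms unfolding bpsd_def by blast
  ultimately show "0 \<le> Re (sesq (d * N) (btoep d N a) v v)" by (simp only:)
qed simp

lemma psd_bsymb:
  assumes s: "bsummable d a" and p: "bpsd d a"
  shows "psd d (bsymb d a x)"
  unfolding psd_def
proof (intro conjI allI impI)
  fix \<alpha> \<beta> assume ab: "\<alpha> < d" "\<beta> < d"
  have "(\<Sum>\<^sub>\<infinity>n. a \<beta> \<alpha> n * fchar x n) = (\<Sum>\<^sub>\<infinity>n. cnj (a \<alpha> \<beta> (0 - n) * fchar x (0 - n)))"
  proof (rule infsum_cong)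
    fix n
    have "a \<beta> \<alpha> n = cnj (a \<alpha> \<beta> (- n))" using p ab unfolding bpsd_def by blast
    thus "a \<beta> \<alpha> n * fchar x n = cnj (a \<alpha> \<beta> (0 - n) * fchar x (0 - n))"
      by (simp add: cnj_fchar)
  qed
  also have "\<dots> = cnj (\<Sum>\<^sub>\<infinity>n. a \<alpha> \<beta> (0 - n) * fchar x (0 - n))" by (rule infsum_cnj)
  also have "(\<Sum>\<^sub>\<infinity>n. a \<alpha> \<beta> (0 - n) * fchar x (0 - n)) = (\<Sum>\<^sub>\<infinity>n. a \<alpha> \<beta> n * fchar x n)"
    by (rule infsum_int_shift(2))
  finally show "bsymb d a x $$ (\<beta>, \<alpha>) = cnj (bsymb d a x $$ (\<alpha>, \<beta>))"
    using ab by (simp add: bsymb_def)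
next
  fix v :: "nat \<Rightarrow> complex"
  define S where "S N = (\<Sum>\<alpha><d. \<Sum>\<beta><d. cnj (v \<alpha>) *
      ((\<Sum>i<N. \<Sum>j<N. a \<alpha> \<beta> (int i - int j) * fchar x (int i - int j)) / of_nat N) * v \<beta>)" for N
  have "S \<longlonglongrightarrow> (\<Sum>\<alpha><d. \<Sum>\<beta><d. cnj (v \<alpha>) * (\<Sum>\<^sub>\<infinity>n. a \<alpha> \<beta> n * fchar x n) * v \<beta>)"
    unfolding S_def using s by (intro tendsto_intros fourier_cesaro) (auto simp: bsummable_def)
  hence lim: "S \<longlonglongrightarrow> sesq d (bsymb d a x) v v" by (simp add: sesq_def bsymb_def)
  have nonneg: "0 \<le> Re (S N)" for N
  proof -
    \<comment> \<open>Modulating the test vector makes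
      \<open>cnj (w \<alpha> i) * w \<beta> j\<close> produce the factor
      \<open>fchar x (i - j)\<close>, so the form of the section at \<open>w\<close> is
      \<open>N\<close> times the Cesaro expression \<open>S N\<close>.\<close>
    define w where "w \<alpha> i = v \<alpha> * fchar x (- int i)" for \<alpha> i
    have "(\<Sum>\<alpha><d. \<Sum>i<N. \<Sum>\<beta><d. \<Sum>j<N. cnj (w \<alpha> i) * a \<alpha> \<beta> (int i - int j) * w \<beta> j)
       = (\<Sum>\<alpha><d. \<Sum>\<beta><d. \<Sum>i<N. \<Sum>j<N. cnj (w \<alpha> i) * a \<alpha> \<beta> (int i - int j) * w \<beta> j)"
      by (rule sum.cong[OF refl]) (rule sum.swap)
    also have "\<dots> = (\<Sum>\<alpha><d. \<Sum>\<beta><d. cnj (v \<alpha>) *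
        (\<Sum>i<N. \<Sum>j<N. a \<alpha> \<beta> (int i - int j) * fchar x (int i - int j)) * v \<beta>)"
    proof (intro sum.cong refl)
      fix \<alpha> \<beta>
      have "cnj (w \<alpha> i) * a \<alpha> \<beta> (int i - int j) * w \<beta> j
          = cnj (v \<alpha>) * (a \<alpha> \<beta> (int i - int j) * fchar x (int i - int j)) * v \<beta>" for i j
        using fchar_add[of x "int i" "- int j"] by (simp add: w_def cnj_fchar)
      thus "(\<Sum>i<N. \<Sum>j<N. cnj (w \<alpha> i) * a \<alpha> \<beta> (int i - int j) * w \<beta> j)
          = cnj (v \<alpha>) * (\<Sum>i<N. \<Sum>j<N. a \<alpha> \<beta> (int i - int j) * fchar x (int i - int j)) * v \<beta>"
        by (simp only: sum_distrib_left sum_distrib_right)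
    qed
    also have "\<dots> / of_nat N = S N" 
      by (simp only: S_def sum_divide_distrib[where A = "{..<d}"] times_divide_eq_left times_divide_eq_right)
    finally have "S N = (\<Sum>\<alpha><d. \<Sum>i<N. \<Sum>\<beta><d. \<Sum>j<N. cnj (w \<alpha> i) * a \<alpha> \<beta> (int i - int j) * w \<beta> j) / of_nat N"
      by simp
    moreover have "0 \<le> Re (\<Sum>\<alpha><d. \<Sum>i<N. \<Sum>\<beta><d. \<Sum>j<N. cnj (w \<alpha> i) * a \<alpha> \<beta> (int i - int j) * w \<beta> j)"
      using p unfolding bpsd_def by blast
    ultimately show ?thesis by (simp only: Re_divide_of_nat) simp
  qed
  show "0 \<le> Re (sesq d (bsymb d a x) v v)"
    by (rule LIMSEQ_le_const[OF tendsto_Re[OF lim]]) (use nonneg in auto)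
qed simp

section \<open>Absolutely convergent Fourier series: continuity and termwise integration\<close>

lemma uniform_limit_fourier:
  assumes u: "u abs_summable_on UNIV"
  shows "uniform_limit S (\<lambda>F x. \<Sum>n\<in>F. u n * fchar x n) (\<lambda>x. \<Sum>\<^sub>\<infinity>n. u n * fchar x n)
           (finite_subsets_at_top UNIV)"
  by (rule Weierstrass_m_test_general[OF _ u]) (simp add: norm_mult)

lemma continuous_on_fourier:
  assumes u: "u abs_summable_on UNIV"
  shows "continuous_on S (\<lambda>x. \<Sum>\<^sub>\<infinity>n. u n * fchar x n)"
  by (rule uniform_limit_theorem[OF _ uniform_limit_fourier[OF u]])
     (auto intro!: always_eventually continuous_intros)

lemma has_integral_fchar:
  "((\<lambda>x. fchar x n) has_integral (if n = 0 then 1 else 0)) {-1/2..1/2}"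
proof (cases "n = 0")
  case True
  thus ?thesis using has_integral_const_real[of "1::complex" "-1/2" "1/2"] by simp
next
  case False
  define F where "F x = fchar x n / (2 * pi * n * \<i>)" for x
  have "((\<lambda>x. fchar x n) has_integral (F (1/2) - F (-1/2))) {-1/2..1/2}"
  proof (rule fundamental_theorem_of_calculus)
    fix x :: real
    have "(F has_vector_derivative fchar x n) (at x)"
    proof -
      have "((\<lambda>z. exp (\<i> * (2 * pi * z * n)) / (2 * pi * n * \<i>)) has_field_derivative
          exp (\<i> * (2 * pi * of_real x * n))) (at (of_real x))"
        using False by (auto intro!: derivative_eq_intros)
      from has_vector_derivative_real_field[OF this] show ?thesis
        by (simp add: F_def[abs_def] fchar_def)
    qed
    thus "(F has_vector_derivative fchar x n) (at x within {-1/2..1/2})"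
      by (rule has_vector_derivative_at_within)
  qed simp
  moreover have "fchar (1/2) n = fchar (-1/2) n"
  proof -
    have "fchar (1/2) n = fchar (-1/2) n * exp (2 * of_int n * pi * \<i>)"
      unfolding fchar_def exp_add[symmetric] by (simp add: algebra_simps)
    also have "exp (2 * of_int n * pi * \<i>) = 1" using exp_integer_2pi[of "of_int n"] by (simp add: mult_ac)
    finally show ?thesis by simp
  qed
  ultimately show ?thesis using False by (simp add: F_def)
qed

text \<open>Every finite partial sum that contains the index 0 already integrates to
  \<open>u 0\<close>, and the convergence is uniform.\<close>

lemma has_integral_fourier:
  assumes u: "u abs_summable_on UNIV"
  shows "((\<lambda>x. \<Sum>\<^sub>\<infinity>n. u n * fchar x n) has_integral u 0) {-1/2..1/2}"
proof -
  obtain I J where I: "\<And>F. ((\<lambda>x. \<Sum>n\<in>F. u n * fchar x n) has_integral I F) {-1/2..1/2}"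
    and J: "((\<lambda>x. \<Sum>\<^sub>\<infinity>n. u n * fchar x n) has_integral J) {-1/2..1/2}"
    and lim: "(I \<longlongrightarrow> J) (finite_subsets_at_top UNIV)"
  proof (rule uniform_limit_integral[OF uniform_limit_fourier[OF u, of "{-1/2..1/2}"]])
    show "continuous_on {-1/2..1/2} (\<lambda>x. \<Sum>n\<in>F. u n * fchar x n)" for F
      by (intro continuous_intros)
  qed auto
  have I0: "I F = u 0" if "finite F" "0 \<in> F" for F
  proof -
    have "((\<lambda>x. \<Sum>n\<in>F. u n * fchar x n) has_integral (\<Sum>n\<in>F. u n * (if n = 0 then 1 else 0))) {-1/2..1/2}"
      by (intro has_integral_sum has_integral_mult_right has_integral_fchar that)
    with I[of F] have "I F = (\<Sum>n\<in>F. u n * (if n = 0 then 1 else 0))" by (rule has_integral_unique)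
    also have "\<dots> = u 0" using that by (simp add: if_distrib sum.delta cong: if_cong)
    finally show ?thesis .
  qed
  have "((\<lambda>F :: int set. u 0) \<longlongrightarrow> J) (finite_subsets_at_top UNIV)"
  proof (rule Lim_transform_eventually[OF lim])
    show "\<forall>\<^sub>F F in finite_subsets_at_top UNIV. I F = u 0"
      unfolding eventually_finite_subsets_at_top using I0 by (intro exI[of _ "{0}"]) auto
  qed
  hence "J = u 0" by (simp add: tendsto_const_iff)
  thus ?thesis using J by simp
qed

lemma continuous_on_det:
  fixes A :: "'a :: topological_space \<Rightarrow> complex mat"
  assumes A: "\<And>x. A x \<in> carrier_mat n n"
    and cont: "\<And>i j. i < n \<Longrightarrow> j < n \<Longrightarrow> continuous_on S (\<lambda>x. A x $$ (i, j))"
  shows "continuous_on S (\<lambda>x. det (A x))"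
proof -
  have "continuous_on S (\<lambda>x. \<Sum>p | p permutes {0..<n}. signof p * (\<Prod>i = 0..<n. A x $$ (i, p i)))"
  proof (intro continuous_intros cont)
    fix p i assume "p \<in> {p. p permutes {0..<n}}" "i \<in> {0..<n}"
    thus "i < n" "p i < n" using permutes_in_image[of p "{0..<n}" i] by auto
  qed
  thus ?thesis by (simp add: det_def'[OF A])
qed

lemma has_integral_abs_diff_le:
  fixes f g :: "real \<Rightarrow> real"
  assumes "(f has_integral I) {-1/2..1/2}" "(g has_integral J) {-1/2..1/2}"
    and "\<And>x. x \<in> {-1/2..1/2} \<Longrightarrow> \<bar>f x - g x\<bar> \<le> c"
  shows "\<bar>I - J\<bar> \<le> c"
proof -
  have "((\<lambda>x. f x - g x) has_integral I - J) {-1/2..1/2}"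
    by (intro has_integral_diff assms)
  moreover have "0 \<le> c" using assms(3)[of 0] by simp
  ultimately have "norm (I - J) \<le> c * Henstock_Kurzweil_Integration.content {-1/2..1/2::real}"
    using assms(3) by (intro has_integral_bound_real[where f = "\<lambda>x. f x - g x"]) auto
  thus ?thesis by simp
qed

text \<open>A Szego limit theorem. The number \<open>Q\<close> stands between the two sides: it is
  the limit of the polynomial moments of the sections and, by termwise integration, the integral of
  the same moments of the symbol. Each side differs from its moments by at most
  \<open>d * \<epsilon>'\<close>.\<close>

lemma szego_psd_product:
  assumes a: "bsummable d a" "bpsd d a" and b: "bsummable d b" "bpsd d b"
  shows "(\<lambda>N. ln (Re (det (1\<^sub>m (d * N) + btoep d N a * btoep d N b))) / real N)
     \<longlonglongrightarrow> integral {-1/2..1/2} (\<lambda>x. ln (Re (det (1\<^sub>m d + bsymb d a x * bsymb d b x))))"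
    (is "?L \<longlonglongrightarrow> integral _ ?l")
proof (rule LIMSEQ_I)
  fix \<epsilon> :: real assume \<epsilon>: "\<epsilon> > 0"
  define K where "K = bnorm d a * bnorm d b"
  \<comment> \<open>The budget is split in three: polynomial error on the sections, polynomial error
    on the symbol, and convergence of the moments. A matrix of size \<open>d * N\<close> divided by
    \<open>N\<close> costs \<open>d\<close> times the scalar error; the added 1 covers
    \<open>d = 0\<close>.\<close>
  define \<epsilon>' where "\<epsilon>' = \<epsilon> / (3 * (real d + 1))"
  have \<epsilon>': "\<epsilon>' > 0" "real d * \<epsilon>' \<le> \<epsilon> / 3" using \<epsilon> by (simp_all add: \<epsilon>'_def field_simps)
  have "compact {0..K}" "continuous_on {0..K} (\<lambda>x. ln (1 + x))"
    by (auto intro!: continuous_intros)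
  from Stone_Weierstrass_real_polynomial_function[OF this \<epsilon>'(1)]
  obtain g where g: "real_polynomial_function g" "\<And>x. x \<in> {0..K} \<Longrightarrow> \<bar>ln (1 + x) - g x\<bar> < \<epsilon>'"
    by blast
  obtain c m where gc: "g = (\<lambda>x. \<Sum>k\<le>m. c k * x ^ k)"
    using g(1) by (auto simp: real_polynomial_function_iff_sum)
  have approx: "\<bar>ln (1 + x) - (\<Sum>k\<le>m. c k * x ^ k)\<bar> \<le> \<epsilon>'" if "0 \<le> x" "x \<le> K" for x
    using g(2)[of x] that by (simp add: gc)
  define M where "M N = btoep d N a * btoep d N b" for N
  define W where "W x = bsymb d a x * bsymb d b x" for x
  define t where "t k = (\<Sum>\<alpha><d. bpow d (bconv d a b) k \<alpha> \<alpha> 0)" for k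
  define Q where "Q = (\<Sum>k\<le>m. c k * Re (t k))"
  have fin: "\<bar>ln (Re (det (1\<^sub>m (d * N) + M N))) - (\<Sum>k\<le>m. c k * Re (mtrace (M N ^\<^sub>m k)))\<bar>
      \<le> real (d * N) * \<epsilon>'" for N
    unfolding M_def
    by (rule ln_det_moment_approx[OF psd_btoep[OF a(2)] psd_btoep[OF b(2)] _ approx, unfolded K_def[symmetric]])
       (auto simp: K_def intro!: row_sum_mult_le btoep_row_sum a b bnorm_nonneg)
  have symb: "1 \<le> Re (det (1\<^sub>m d + W x))"
      "\<bar>ln (Re (det (1\<^sub>m d + W x))) - (\<Sum>k\<le>m. c k * Re (mtrace (W x ^\<^sub>m k)))\<bar> \<le> real d * \<epsilon>'" for x
    unfolding W_def
    by (rule ln_det_moment_approx[OF psd_bsymb[OF a] psd_bsymb[OF b] _ approx, unfolded K_def[symmetric]];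
        auto simp: K_def intro!: row_sum_mult_le bsymb_row_sum a b bnorm_nonneg)+
  have Wtr: "mtrace (W x ^\<^sub>m k) = (\<Sum>\<alpha><d. \<Sum>\<^sub>\<infinity>n. bpow d (bconv d a b) k \<alpha> \<alpha> n * fchar x n)" for x k
  proof -
    have "W x ^\<^sub>m k = bsymb d (bpow d (bconv d a b) k) x"
      using a b by (simp add: W_def bsymb_bpow bsymb_bconv bsummable_bconv)
    thus ?thesis by (simp add: mtrace_def bsymb_def)
  qed
  have tr_int: "((\<lambda>x. mtrace (W x ^\<^sub>m k)) has_integral t k) {-1/2..1/2}" for k
    unfolding Wtr t_def
    by (intro has_integral_sum has_integral_fourier)
       (use bsummable_bpow[OF bsummable_bconv[OF a(1) b(1)], of k] in \<open>auto simp: bsummable_def\<close>)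
  have Q_int: "((\<lambda>x. \<Sum>k\<le>m. c k * Re (mtrace (W x ^\<^sub>m k))) has_integral Q) {-1/2..1/2}"
    unfolding Q_def
    by (intro has_integral_sum has_integral_mult_right has_integral_linear[OF tr_int bounded_linear_Re, unfolded o_def]) auto
  have cont: "continuous_on {-1/2..1/2} (\<lambda>x. ln (Re (det (1\<^sub>m d + W x))))"
  proof (rule continuous_on_ln)
    show "continuous_on {-1/2..1/2} (\<lambda>x. Re (det (1\<^sub>m d + W x)))"
    proof (intro continuous_on_Re continuous_on_det[of _ d])
      show "1\<^sub>m d + W x \<in> carrier_mat d d" for x by (auto simp: W_def bsymb_def)
      fix i j assume ij: "i < d" "j < d"
      have entry: "(1\<^sub>m d + W x) $$ (i, j) = (if i = j then 1 else 0)
          + (\<Sum>k<d. (\<Sum>\<^sub>\<infinity>n. a i k n * fchar x n) * (\<Sum>\<^sub>\<infinity>n. b k j n * fchar x n))" for x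
      proof -
        have "W x $$ (i, j) = (\<Sum>k<d. bsymb d a x $$ (i, k) * bsymb d b x $$ (k, j))"
          unfolding W_def using ij by (intro index_mult_mat_lessThan) auto
        moreover have "W x \<in> carrier_mat d d" by (auto simp: W_def bsymb_def)
        ultimately show ?thesis using ij by (simp add: bsymb_def)
      qed
      show "continuous_on {-1/2..1/2} (\<lambda>x. (1\<^sub>m d + W x) $$ (i, j))"
        unfolding entry using a(1) b(1) ij
        by (intro continuous_intros continuous_on_fourier) (auto simp: bsummable_def)
    qed
    show "\<forall>x\<in>{-1/2..1/2}. Re (det (1\<^sub>m d + W x)) \<noteq> 0"
      using symb(1) by (metis not_one_le_zero)
  qed
  have l_int: "(?l has_integral integral {-1/2..1/2} ?l) {-1/2..1/2}"
    using integrable_continuous_interval[OF cont] unfolding W_def by (rule integrable_integral)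
  have lQ: "\<bar>integral {-1/2..1/2} ?l - Q\<bar> \<le> real d * \<epsilon>'"
    by (rule has_integral_abs_diff_le[OF l_int Q_int]) (use symb(2) in \<open>simp add: W_def\<close>)
  have "(\<lambda>N. \<Sum>k\<le>m. c k * Re (mtrace (M N ^\<^sub>m k) / of_nat N)) \<longlonglongrightarrow> Q"
    unfolding M_def Q_def t_def by (intro tendsto_intros btoep_moment_limit a b)
  from LIMSEQ_D[OF this, of "\<epsilon> / 3"] \<epsilon>
  obtain N0 where N0: "\<And>N. N \<ge> N0 \<Longrightarrow> \<bar>(\<Sum>k\<le>m. c k * Re (mtrace (M N ^\<^sub>m k) / of_nat N)) - Q\<bar> < \<epsilon> / 3"
    by auto
  show "\<exists>N0. \<forall>N\<ge>N0. norm (?L N - integral {-1/2..1/2} ?l) < \<epsilon>"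
  \<comment> \<open>The successor keeps \<open>N\<close> positive, so that dividing the error for
    size \<open>d * N\<close> by \<open>N\<close> leaves \<open>d * \<epsilon>'\<close>.\<close>
  proof (intro exI[of _ "Suc N0"] allI impI)
    fix N assume N: "N \<ge> Suc N0"
    have "?L N - (\<Sum>k\<le>m. c k * Re (mtrace (M N ^\<^sub>m k) / of_nat N))
       = (ln (Re (det (1\<^sub>m (d * N) + M N))) - (\<Sum>k\<le>m. c k * Re (mtrace (M N ^\<^sub>m k)))) / real N"
      by (simp add: M_def diff_divide_distrib sum_divide_distrib Re_divide_of_nat)
    also have "\<bar>\<dots>\<bar> \<le> real (d * N) * \<epsilon>' / real N"
      using divide_right_mono[OF fin[of N], of "real N"] by (simp only: abs_divide abs_of_nat)
    also have "\<dots> = real d * \<epsilon>'" using N by simp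
    finally show "norm (?L N - integral {-1/2..1/2} ?l) < \<epsilon>"
      using lQ N0[of N] N \<epsilon>'(2) unfolding real_norm_def by linarith
  qed
qed

subsection \<open>Fourier uniqueness for even integrable functions\<close>

abbreviation (input) unit_ivl :: "real set" where "unit_ivl \<equiv> {-1/2..1/2}"

lemma cos_2pi_fchar: "complex_of_real (cos (2 * pi * x)) = (fchar x 1 + fchar x (- 1)) / 2"
  by (simp add: fchar_def cos_of_real[symmetric] cos_exp_eq)

text \<open>Multiplying by \<open>cos (2 * pi * x)\<close> averages the frequencies
  \<open>n + 1\<close> and \<open>n - 1\<close>, so vanishing at all frequencies passes from
  \<open>k\<close> to \<open>k + 1\<close>. At \<open>n = 0\<close> this says that \<open>h\<close>
  is orthogonal to all powers of the cosine.\<close>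

lemma even_moments_zero:
  fixes h :: "real \<Rightarrow> real"
  assumes "\<And>n. ((\<lambda>x. complex_of_real (h x) * fchar x n) has_integral 0) unit_ivl"
  shows "((\<lambda>x. complex_of_real (h x * cos (2 * pi * x) ^ k) * fchar x n) has_integral 0) unit_ivl"
proof (induction k arbitrary: n)
  case 0
  thus ?case using assms by simp
next
  case (Suc k)
  have "((\<lambda>x. (complex_of_real (h x * cos (2 * pi * x) ^ k) * fchar x (n + 1)
      + complex_of_real (h x * cos (2 * pi * x) ^ k) * fchar x (n + - 1)) / 2) has_integral (0 + 0) / 2) unit_ivl"
    by (intro has_integral_divide has_integral_add Suc.IH)
  also have "(\<lambda>x. (complex_of_real (h x * cos (2 * pi * x) ^ k) * fchar x (n + 1)
      + complex_of_real (h x * cos (2 * pi * x) ^ k) * fchar x (n + - 1)) / 2)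
     = (\<lambda>x. complex_of_real (h x * cos (2 * pi * x) ^ Suc k) * fchar x n)"
  proof
    fix x
    have eq: "complex_of_real (h x * cos (2 * pi * x) ^ Suc k)
        = complex_of_real (h x * cos (2 * pi * x) ^ k) * ((fchar x 1 + fchar x (- 1)) / 2)"
      by (simp flip: cos_2pi_fchar)
    show "(complex_of_real (h x * cos (2 * pi * x) ^ k) * fchar x (n + 1)
      + complex_of_real (h x * cos (2 * pi * x) ^ k) * fchar x (n + - 1)) / 2
      = complex_of_real (h x * cos (2 * pi * x) ^ Suc k) * fchar x n"
      unfolding eq fchar_add by (simp add: algebra_simps add_divide_distrib)
  qed
  finally show ?case by simp
qed

lemma absolutely_integrable_continuous_mult:
  fixes h f :: "real \<Rightarrow> real"
  assumes "h absolutely_integrable_on {a..b}" "continuous_on {a..b} f"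
  shows "(\<lambda>x. h x * f x) absolutely_integrable_on {a..b}"
proof -
  have "(\<lambda>x. f x * h x) absolutely_integrable_on {a..b}"
    using assms
    by (intro absolutely_integrable_bounded_measurable_product_real compact_imp_bounded
        compact_continuous_image continuous_imp_measurable_on_sets_lebesgue) auto
  thus ?thesis by (simp add: mult.commute)
qed

text \<open>The substitution \<open>y = cos (2 \<pi> x)\<close> turns even continuous functions on the unit interval into
  continuous functions on \<open>[-1, 1]\<close>, where algebraic polynomials are dense.\<close>

lemma even_test_functions_zero:
  fixes h \<phi> :: "real \<Rightarrow> real"
  assumes h: "h absolutely_integrable_on unit_ivl"
    and zero: "\<And>n. ((\<lambda>x. complex_of_real (h x) * fchar x n) has_integral 0) unit_ivl"
    and \<phi>: "continuous_on UNIV \<phi>"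
  shows "((\<lambda>x. h x * \<phi> \<bar>x\<bar>) has_integral 0) unit_ivl"
proof -
  have mom: "((\<lambda>x. h x * cos (2 * pi * x) ^ k) has_integral 0) unit_ivl" for k
    using has_integral_linear[OF even_moments_zero[OF zero, of k 0] bounded_linear_Re]
    by (simp add: o_def)
  have cont: "continuous_on S (\<lambda>x. \<phi> \<bar>x\<bar>)" for S
    by (rule continuous_on_compose2[OF \<phi>]) (auto intro!: continuous_intros)
  have int: "(\<lambda>x. h x * \<phi> \<bar>x\<bar>) integrable_on unit_ivl"
    using absolutely_integrable_continuous_mult[OF h cont] by (rule set_lebesgue_integral_eq_integral(1))
  define H where "H = integral unit_ivl (\<lambda>x. \<bar>h x\<bar>)"
  have H: "((\<lambda>x. \<bar>h x\<bar>) has_integral H) unit_ivl"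
    using h unfolding H_def absolutely_integrable_on_def by (simp add: integrable_integral)
  have H0: "H \<ge> 0" using has_integral_nonneg[OF H] by simp
  let ?I = "integral unit_ivl (\<lambda>x. h x * \<phi> \<bar>x\<bar>)"
  have bound: "\<bar>?I\<bar> \<le> H * \<epsilon>" if \<epsilon>: "\<epsilon> > 0" for \<epsilon>
  proof -
    have "continuous_on {-1..1} (\<lambda>y. \<phi> (arccos y / (2 * pi)))"
      by (rule continuous_on_compose2[OF \<phi>]) (auto intro!: continuous_intros)
    from Stone_Weierstrass_real_polynomial_function[OF _ this \<epsilon>]
    obtain g where g: "real_polynomial_function g"
      "\<And>y. y \<in> {-1..1} \<Longrightarrow> \<bar>\<phi> (arccos y / (2 * pi)) - g y\<bar> < \<epsilon>"
      by auto
    obtain c m where gc: "g = (\<lambda>x. \<Sum>k\<le>m. c k * x ^ k)"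
      using g(1) by (auto simp: real_polynomial_function_iff_sum)
    have "((\<lambda>x. \<Sum>k\<le>m. c k * (h x * cos (2 * pi * x) ^ k)) has_integral (\<Sum>k\<le>m. c k * 0)) unit_ivl"
      by (intro has_integral_sum has_integral_mult_right mom) auto
    hence g0: "((\<lambda>x. h x * g (cos (2 * pi * x))) has_integral 0) unit_ivl"
      by (simp add: gc sum_distrib_left mult_ac)
    have diff: "((\<lambda>x. h x * \<phi> \<bar>x\<bar> - h x * g (cos (2 * pi * x))) has_integral ?I - 0) unit_ivl"
      by (intro has_integral_diff g0 integrable_integral int)
    have "\<bar>\<phi> \<bar>x\<bar> - g (cos (2 * pi * x))\<bar> \<le> \<epsilon>" if x: "x \<in> unit_ivl" for x
    proof -
      have "cos (2 * pi * x) = cos (2 * pi * \<bar>x\<bar>)" by (cases "x \<ge> 0") auto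
      moreover have "arccos (cos (2 * pi * \<bar>x\<bar>)) = 2 * pi * \<bar>x\<bar>"
        using x by (intro arccos_cos) (auto simp: abs_if)
      ultimately have "arccos (cos (2 * pi * x)) / (2 * pi) = \<bar>x\<bar>" by simp
      with g(2)[of "cos (2 * pi * x)"] show ?thesis by simp
    qed
    hence "norm (h x * \<phi> \<bar>x\<bar> - h x * g (cos (2 * pi * x))) \<le> \<bar>h x\<bar> * \<epsilon>" if "x \<in> unit_ivl" for x
      using that by (simp add: abs_mult mult_left_mono flip: right_diff_distrib)
    moreover have "((\<lambda>x. \<bar>h x\<bar> * \<epsilon>) has_integral H * \<epsilon>) unit_ivl"
      by (intro has_integral_mult_left H)
    ultimately have "norm (integral unit_ivl (\<lambda>x. h x * \<phi> \<bar>x\<bar> - h x * g (cos (2 * pi * x))))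
        \<le> integral unit_ivl (\<lambda>x. \<bar>h x\<bar> * \<epsilon>)"
      using diff by (intro integral_norm_bound_integral) (auto simp: has_integral_iff)
    thus ?thesis
      using integral_unique[OF diff] integral_unique[OF \<open>((\<lambda>x. \<bar>h x\<bar> * \<epsilon>) has_integral H * \<epsilon>) unit_ivl\<close>]
      by (simp only: diff_zero real_norm_def)
  qed
  have "?I = 0"
  proof (rule ccontr)
    assume "?I \<noteq> 0"
    hence I: "\<bar>?I\<bar> > 0" by simp
    \<comment> \<open>Chosen so that \<open>H * \<epsilon>\<close> is at most half of the supposedly
      nonzero integral; the added 1 covers \<open>H = 0\<close>.\<close>
    define \<epsilon> where "\<epsilon> = \<bar>?I\<bar> / (2 * (H + 1))"
    have "\<epsilon> > 0" using I H0 unfolding \<epsilon>_def by (intro divide_pos_pos) auto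
    moreover have "H * \<epsilon> < \<bar>?I\<bar>"
    proof -
      have "H * \<epsilon> \<le> (H + 1) * \<epsilon>" using \<open>\<epsilon> > 0\<close> by (intro mult_right_mono) auto
      also have "\<dots> = \<bar>?I\<bar> / 2" using H0 by (simp add: \<epsilon>_def field_simps)
      also have "\<dots> < \<bar>?I\<bar>" using I by simp
      finally show ?thesis .
    qed
    ultimately show False using bound[of \<epsilon>] by linarith
  qed
  thus ?thesis using int by (metis integrable_integral)
qed

lemma negligible_abs_vimage:
  assumes "negligible (N :: real set)"
  shows "negligible {x. \<bar>x\<bar> \<in> N}"
proof -
  have "negligible (uminus ` N)"
    using assms by (intro negligible_differentiable_image_negligible) (auto intro!: derivative_intros)
  hence "negligible (N \<union> uminus ` N)" using assms by simp
  moreover have "{x. \<bar>x\<bar> \<in> N} \<subseteq> N \<union> uminus ` N"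
    by (auto simp: abs_if image_iff split: if_splits) (metis minus_minus)
  ultimately show ?thesis by (rule negligible_subset)
qed

lemma negligible_of_integral_abs_zero:
  fixes h :: "real \<Rightarrow> real"
  assumes h: "h absolutely_integrable_on S" and 0: "integral S (\<lambda>x. \<bar>h x\<bar>) = 0"
  shows "negligible {x \<in> S. h x \<noteq> 0}"
proof -
  have a: "(\<lambda>x. \<bar>h x\<bar>) absolutely_integrable_on S" using h by (rule set_integrable_abs)
  have "integral\<^sup>L lebesgue (\<lambda>x. indicat_real S x *\<^sub>R \<bar>h x\<bar>) = 0"
    using set_lebesgue_integral_eq_integral(2)[OF a] 0 by (simp add: set_lebesgue_integral_def)
  moreover have "integrable lebesgue (\<lambda>x. indicat_real S x *\<^sub>R \<bar>h x\<bar>)"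
    using a by (simp add: set_integrable_def)
  ultimately have "AE x in lebesgue. indicat_real S x *\<^sub>R \<bar>h x\<bar> = 0"
    by (subst (asm) integral_nonneg_eq_0_iff_AE) auto
  then obtain N where "negligible N" "{x. indicat_real S x *\<^sub>R \<bar>h x\<bar> \<noteq> 0} \<subseteq> N"
    unfolding eventually_ae_filter_negligible by auto
  moreover have "{x \<in> S. h x \<noteq> 0} \<subseteq> {x. indicat_real S x *\<^sub>R \<bar>h x\<bar> \<noteq> 0}" by auto
  ultimately show ?thesis by (meson negligible_subset order_trans)
qed

text \<open>The best test function is the sign of \<open>h\<close>, which gives the integral of the
  absolute value. It is merely measurable, so it is approached almost everywhere by continuous
  functions, each of which integrates to 0 against \<open>h\<close>; dominated convergence finishes.
  Evenness permits evaluating the approximants at the absolute value of \<open>x\<close>.\<close>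

lemma even_fourier_unique:
  fixes h :: "real \<Rightarrow> real"
  assumes h: "h absolutely_integrable_on unit_ivl"
    and even: "\<And>x. x \<in> unit_ivl \<Longrightarrow> h (- x) = h x"
    and zero: "\<And>n. ((\<lambda>x. complex_of_real (h x) * fchar x n) has_integral 0) unit_ivl"
  shows "negligible {x \<in> unit_ivl. h x \<noteq> 0}"
proof (rule negligible_of_integral_abs_zero[OF h])
  have "h \<in> borel_measurable (lebesgue_on unit_ivl)"
    using h by (rule absolutely_integrable_imp_borel_measurable) auto
  hence "(\<lambda>x. sgn (h x)) \<in> borel_measurable (lebesgue_on unit_ivl)" by simp
  hence "(\<lambda>x. sgn (h x)) measurable_on unit_ivl" by (simp add: measurable_on_iff_borel_measurable)
  \<comment> \<open>The definition of \<open>measurable_on\<close> itself supplies the continuous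
    approximants, together with the null set outside which they converge.\<close>
  then obtain N g where N: "negligible N" and g: "\<And>n :: nat. continuous_on UNIV (g n)"
    and lim: "\<And>x. x \<notin> N \<Longrightarrow> (\<lambda>n. g n x) \<longlonglongrightarrow> (if x \<in> unit_ivl then sgn (h x) else 0)"
    unfolding measurable_on_def by blast
  \<comment> \<open>Clipping to \<open>[-1, 1]\<close> leaves the limit \<open>sgn (h x)\<close>
    unchanged and makes the absolute value of \<open>h\<close> a dominating function.\<close>
  define c where "c n x = max (- 1) (min 1 (g n x))" for n x
  have c: "continuous_on UNIV (c n)" for n
    unfolding c_def by (intro continuous_intros g)
  \<comment> \<open>The approximants are evaluated at the absolute value of \<open>x\<close>, so the
    exceptional set has to be pulled back along it.\<close>
  define N' where "N' = {x. \<bar>x\<bar> \<in> N}"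
  have N': "negligible N'" unfolding N'_def by (rule negligible_abs_vimage[OF N])
  define f where "f n x = (if x \<in> N' then 0 else h x * c n \<bar>x\<bar>)" for n x
  have f: "(f n has_integral 0) unit_ivl" for n
    by (rule has_integral_spike[OF N' _ even_test_functions_zero[OF h zero c[of n]]]) (simp add: f_def)
  define F where "F x = (if x \<in> N' then 0 else \<bar>h x\<bar>)" for x
  have "(\<lambda>n. integral unit_ivl (f n)) \<longlonglongrightarrow> integral unit_ivl F"
  proof (rule dominated_convergence(2)[where h = "\<lambda>x. \<bar>h x\<bar>"])
    show "f n integrable_on unit_ivl" for n using f[of n] by blast
    show "(\<lambda>x. \<bar>h x\<bar>) integrable_on unit_ivl" using h by (simp add: absolutely_integrable_on_def)
    show "norm (f n x) \<le> \<bar>h x\<bar>" for n x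
    proof -
      have "\<bar>c n \<bar>x\<bar>\<bar> \<le> 1" by (auto simp: c_def)
      hence "\<bar>h x\<bar> * \<bar>c n \<bar>x\<bar>\<bar> \<le> \<bar>h x\<bar> * 1" by (intro mult_left_mono) auto
      thus ?thesis by (simp add: f_def abs_mult)
    qed
    fix x assume x: "x \<in> unit_ivl"
    show "(\<lambda>n. f n x) \<longlonglongrightarrow> F x"
    proof (cases "x \<in> N'")
      case False
      have ax: "\<bar>x\<bar> \<in> unit_ivl" using x by (auto simp: abs_if)
      have hx: "h \<bar>x\<bar> = h x" using even[OF x] by (simp add: abs_if)
      have "(\<lambda>n. g n \<bar>x\<bar>) \<longlonglongrightarrow> sgn (h x)"
        using lim[of "\<bar>x\<bar>"] False ax hx by (simp add: N'_def)
      hence "(\<lambda>n. h x * max (- 1) (min 1 (g n \<bar>x\<bar>))) \<longlonglongrightarrow> h x * max (- 1) (min 1 (sgn (h x)))"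
        by (intro tendsto_intros)
      moreover have "h x * max (- 1) (min 1 (sgn (h x))) = \<bar>h x\<bar>" by (auto simp: sgn_if abs_if)
      ultimately show ?thesis using False by (simp add: f_def F_def c_def)
    qed (simp add: f_def F_def)
  qed
  hence "(\<lambda>n :: nat. 0) \<longlonglongrightarrow> integral unit_ivl F" by (simp only: integral_unique[OF f])
  hence "integral unit_ivl F = 0" by (simp add: LIMSEQ_const_iff)
  moreover have "integral unit_ivl F = integral unit_ivl (\<lambda>x. \<bar>h x\<bar>)"
    by (rule integral_spike[OF N']) (simp add: F_def)
  ultimately show "integral unit_ivl (\<lambda>x. \<bar>h x\<bar>) = 0" by simp
qed

subsection \<open>Positivity of the pulse and data sequences\<close>

text \<open>Translating the integrand of \<open>autocorr p (a - b)\<close> by \<open>b\<close>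
  places the two pulses at \<open>b\<close> and \<open>a\<close>, the shape that a Gram matrix of
  shifted pulses needs. Square integrability and \<open>2 x y \<le> x^2 + y^2\<close> give the
  integrability without which \<open>integral\<close> would only return its default 0.\<close>

lemma has_integral_autocorr:
  assumes p: "p measurable_on UNIV" and sq: "(\<lambda>s. (cmod (p s))\<^sup>2) integrable_on UNIV"
  shows "((\<lambda>u. p (u - b) * cnj (p (u - a))) has_integral autocorr p (a - b)) UNIV"
proof -
  have m [measurable]: "p \<in> borel_measurable lebesgue"
    by (rule measurable_on_imp_borel_measurable_lebesgue_UNIV[OF p])
  have sh [measurable]: "(\<lambda>s. p (s - c)) \<in> borel_measurable lebesgue" for c
    using borel_measurable_affine[of p 1 "- c"] m by (simp add: add.commute)
  have "(\<lambda>s. (cmod (p s))\<^sup>2) absolutely_integrable_on UNIV"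
    using sq by (intro nonnegative_absolutely_integrable_1) auto
  hence I: "integrable lebesgue (\<lambda>s. (cmod (p s))\<^sup>2)"
    by (simp add: set_integrable_def)
  have Ish: "integrable lebesgue (\<lambda>s. (cmod (p (s - c)))\<^sup>2)" for c
    using lebesgue_integrable_real_affine[OF I, of 1 "- c"] by (simp add: add.commute)
  define q where "q s = p s * cnj (p (s - (a - b)))" for s
  have q: "integrable lebesgue q"
  proof (rule Bochner_Integration.integrable_bound)
    show "integrable lebesgue (\<lambda>s. (cmod (p s))\<^sup>2 + (cmod (p (s - (a - b))))\<^sup>2)"
      by (intro Bochner_Integration.integrable_add I Ish)
    have [measurable]: "cnj \<in> borel_measurable borel"
      by (intro borel_measurable_continuous_onI continuous_intros)
    show "q \<in> borel_measurable lebesgue" unfolding q_def by measurable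
    show "AE s in lebesgue. norm (q s) \<le> norm ((cmod (p s))\<^sup>2 + (cmod (p (s - (a - b))))\<^sup>2)"
    proof (intro always_eventually allI)
      fix s
      have "2 * (cmod (p s) * cmod (p (s - (a - b)))) \<le> (cmod (p s))\<^sup>2 + (cmod (p (s - (a - b))))\<^sup>2"
        using sum_squares_bound[of "cmod (p s)" "cmod (p (s - (a - b)))"] by (simp add: mult.assoc)
      moreover have "0 \<le> cmod (p s) * cmod (p (s - (a - b)))" by simp
      ultimately have "cmod (p s) * cmod (p (s - (a - b))) \<le> (cmod (p s))\<^sup>2 + (cmod (p (s - (a - b))))\<^sup>2"
        by linarith
      thus "norm (q s) \<le> norm ((cmod (p s))\<^sup>2 + (cmod (p (s - (a - b))))\<^sup>2)"
        by (simp add: q_def norm_mult)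
    qed
  qed
  have "has_bochner_integral lebesgue q (autocorr p (a - b))"
    unfolding has_bochner_integral_iff
  proof
    have "autocorr p (a - b) = integral UNIV q" by (simp add: autocorr_def q_def[abs_def])
    thus "integral\<^sup>L lebesgue q = autocorr p (a - b)" by (simp only: integral_lebesgue[OF q])
  qed (rule q)
  hence "has_bochner_integral lebesgue (\<lambda>u. q (- b + 1 * u)) (autocorr p (a - b) /\<^sub>R \<bar>1\<bar>)"
    by (subst (asm) has_bochner_integral_lebesgue_real_affine_iff[of 1 _ _ "- b"]) auto
  moreover have "q (- b + 1 * u) = p (u - b) * cnj (p (u - a))" for u
    by (simp add: q_def algebra_simps)
  ultimately have "has_bochner_integral lebesgue (\<lambda>u. p (u - b) * cnj (p (u - a))) (autocorr p (a - b))"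
    by simp
  thus ?thesis
    using has_integral_integral_lebesgue[of "\<lambda>u. p (u - b) * cnj (p (u - a))"]
    by (auto simp: has_bochner_integral_iff)
qed

lemma autocorr_uminus:
  assumes "p measurable_on UNIV" and "(\<lambda>s. (cmod (p s))\<^sup>2) integrable_on UNIV"
  shows "autocorr p (- t) = cnj (autocorr p t)"
proof -
  have "((\<lambda>u. p (u - t) * cnj (p u)) has_integral autocorr p (- t)) UNIV"
    using has_integral_autocorr[OF assms, of t 0] by simp
  moreover have "((\<lambda>u. p u * cnj (p (u - t))) has_integral autocorr p t) UNIV"
    using has_integral_autocorr[OF assms, of 0 t] by simp
  hence "((\<lambda>u. p (u - t) * cnj (p u)) has_integral cnj (autocorr p t)) UNIV"
    by (subst (asm) has_integral_cnj[symmetric]) (simp add: o_def mult.commute)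
  ultimately show ?thesis by (rule has_integral_unique)
qed

text \<open>\<open>D\<close> is the sampling step, \<open>\<tau>\<close> the list of user delays,
  and \<open>c\<close> is 1 for the matrices themselves and \<open>1 / \<sigma>2\<close> when the
  noise level is absorbed. Equal users give \<open>G\<close>, the pairs of distinct users the two
  cross blocks.\<close>

definition pulse_seq :: "(real \<Rightarrow> complex) \<Rightarrow> real \<Rightarrow> real \<Rightarrow> (nat \<Rightarrow> real) \<Rightarrow> bseq" where
  "pulse_seq p c D \<tau> \<alpha> \<beta> n = of_real c * autocorr p (real_of_int n * D + (\<tau> \<alpha> - \<tau> \<beta>))"

text \<open>The coefficients form a Gram matrix: the quadratic form at \<open>v\<close> is
  \<open>c\<close> times the energy of the waveform \<open>F\<close>, in which user
  \<open>\<beta>\<close> sends \<open>v \<beta> j\<close> on a pulse delayed by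
  \<open>j * D + \<tau> \<beta>\<close>.\<close>

lemma bpsd_pulse_seq:
  assumes p: "p measurable_on UNIV" "(\<lambda>s. (cmod (p s))\<^sup>2) integrable_on UNIV" and c: "c \<ge> 0"
  shows "bpsd d (pulse_seq p c D \<tau>)"
  unfolding bpsd_def
proof (intro conjI allI impI)
  fix \<alpha> \<beta> n
  have "real_of_int n * D + (\<tau> \<beta> - \<tau> \<alpha>) = - (real_of_int (- n) * D + (\<tau> \<alpha> - \<tau> \<beta>))"
    by simp
  thus "pulse_seq p c D \<tau> \<beta> \<alpha> n = cnj (pulse_seq p c D \<tau> \<alpha> \<beta> (- n))"
    unfolding pulse_seq_def by (simp only: autocorr_uminus[OF p]) simp
next
  fix N and v :: "nat \<Rightarrow> nat \<Rightarrow> complex"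
  define t where "t \<alpha> i = real i * D + \<tau> \<alpha>" for \<alpha> i
  have arg: "pulse_seq p c D \<tau> \<alpha> \<beta> (int i - int j) = of_real c * autocorr p (t \<alpha> i - t \<beta> j)" for \<alpha> \<beta> i j
    by (simp add: pulse_seq_def t_def algebra_simps)
  let ?Q = "\<Sum>\<alpha><d. \<Sum>i<N. \<Sum>\<beta><d. \<Sum>j<N. cnj (v \<alpha> i) * pulse_seq p c D \<tau> \<alpha> \<beta> (int i - int j) * v \<beta> j"
  define F where "F u = (\<Sum>\<beta><d. \<Sum>j<N. p (u - t \<beta> j) * v \<beta> j)" for u
  have "((\<lambda>u. \<Sum>\<alpha><d. \<Sum>i<N. \<Sum>\<beta><d. \<Sum>j<N.
       cnj (v \<alpha> i) * (of_real c * (p (u - t \<beta> j) * cnj (p (u - t \<alpha> i)))) * v \<beta> j) has_integral ?Q) UNIV"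
    unfolding arg
    by (intro has_integral_sum has_integral_mult_left has_integral_mult_right has_integral_autocorr p) auto
  also have "(\<lambda>u. \<Sum>\<alpha><d. \<Sum>i<N. \<Sum>\<beta><d. \<Sum>j<N.
       cnj (v \<alpha> i) * (of_real c * (p (u - t \<beta> j) * cnj (p (u - t \<alpha> i)))) * v \<beta> j)
     = (\<lambda>u. of_real (c * (cmod (F u))\<^sup>2))"
  proof
    fix u
    have "of_real (c * (cmod (F u))\<^sup>2) = of_real c * (cnj (F u) * F u)"
      unfolding of_real_mult complex_norm_square by (simp add: mult.commute)
    also have "\<dots> = (\<Sum>\<alpha><d. \<Sum>i<N. \<Sum>\<beta><d. \<Sum>j<N.
       cnj (v \<alpha> i) * (of_real c * (p (u - t \<beta> j) * cnj (p (u - t \<alpha> i)))) * v \<beta> j)"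
      by (simp add: F_def sum_distrib_left sum_distrib_right mult_ac)
         (rule sum.cong[OF refl], rule sum.swap)
    finally show "(\<Sum>\<alpha><d. \<Sum>i<N. \<Sum>\<beta><d. \<Sum>j<N.
       cnj (v \<alpha> i) * (of_real c * (p (u - t \<beta> j) * cnj (p (u - t \<alpha> i)))) * v \<beta> j)
       = of_real (c * (cmod (F u))\<^sup>2)" ..
  qed
  finally have "((\<lambda>u. complex_of_real (c * (cmod (F u))\<^sup>2)) has_integral ?Q) UNIV" .
  from has_integral_linear[OF this bounded_linear_Re]
  have "((\<lambda>u. c * (cmod (F u))\<^sup>2) has_integral Re ?Q) UNIV"
    unfolding o_def Re_complex_of_real .
  thus "0 \<le> Re ?Q" by (rule has_integral_nonneg) (use c in simp)
qed

text \<open>Nonnegativity makes \<open>S\<close> its own dominating function, so the oscillating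
  factor cannot spoil gauge integrability.\<close>

lemma has_integral_fcoef:
  assumes S: "S integrable_on unit_ivl" "\<And>x. x \<in> unit_ivl \<Longrightarrow> S x \<ge> 0"
  shows "((\<lambda>x. complex_of_real (S x) * fchar x n) has_integral fcoef S n) unit_ivl"
proof -
  have "(\<lambda>x. complex_of_real (S x) * fchar x n) integrable_on unit_ivl"
  proof (rule measurable_bounded_by_integrable_imp_integrable[OF _ S(1)])
    have "(\<lambda>x. fchar x n) \<in> borel_measurable (lebesgue_on unit_ivl)"
      by (intro continuous_imp_measurable_on_sets_lebesgue continuous_intros) auto
    thus "(\<lambda>x. complex_of_real (S x) * fchar x n) \<in> borel_measurable (lebesgue_on unit_ivl)"
      using integrable_imp_measurable[OF S(1)] by measurable
  qed (use S(2) in \<open>auto simp: norm_mult\<close>)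
  thus ?thesis unfolding fcoef_def fchar_def by (rule integrable_integral)
qed

lemma cnj_fcoef: "cnj (fcoef S n) = fcoef S (- n)"
  unfolding fcoef_def fchar_def[symmetric] integral_cnj by (simp add: cnj_fchar)

lemma fcoef_even:
  assumes "\<And>x. x \<in> unit_ivl \<Longrightarrow> S (- x) = S x"
  shows "fcoef S (- n) = fcoef S n"
proof -
  have "fcoef S n = integral {- (1/2)..- (- 1/2)} (\<lambda>x. complex_of_real (S x) * fchar x n)"
    by (simp add: fcoef_def fchar_def)
  also have "\<dots> = integral {- (1/2)..1/2} (\<lambda>x. complex_of_real (S (- x)) * fchar (- x) n)"
    by (subst Henstock_Kurzweil_Integration.integral_reflect_real[symmetric]) simp
  also have "\<dots> = integral {- (1/2)..1/2} (\<lambda>x. complex_of_real (S x) * fchar x (- n))"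
    by (rule integral_cong) (use assms in \<open>simp add: fchar_uminus_arg\<close>)
  finally show ?thesis by (simp add: fcoef_def fchar_def)
qed

definition diag_seq :: "(nat \<Rightarrow> real \<Rightarrow> real) \<Rightarrow> bseq" where
  "diag_seq S \<alpha> \<beta> n = (if \<alpha> = \<beta> then fcoef (S \<alpha>) n else 0)"

text \<open>The form decouples over the users, and for each user it is the integral of
  \<open>S \<alpha>\<close> against the squared modulus of a trigonometric polynomial.\<close>

lemma bpsd_diag_seq:
  assumes S: "\<And>\<alpha>. \<alpha> < d \<Longrightarrow> S \<alpha> integrable_on unit_ivl"
    "\<And>\<alpha> x. \<alpha> < d \<Longrightarrow> x \<in> unit_ivl \<Longrightarrow> S \<alpha> x \<ge> 0"
  shows "bpsd d (diag_seq S)"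
  unfolding bpsd_def
proof (intro conjI allI impI)
  show "diag_seq S \<beta> \<alpha> n = cnj (diag_seq S \<alpha> \<beta> (- n))" for \<alpha> \<beta> n
    by (simp add: diag_seq_def cnj_fcoef)
next
  fix N and v :: "nat \<Rightarrow> nat \<Rightarrow> complex"
  have eq: "(\<Sum>\<alpha><d. \<Sum>i<N. \<Sum>\<beta><d. \<Sum>j<N. cnj (v \<alpha> i) * diag_seq S \<alpha> \<beta> (int i - int j) * v \<beta> j)
     = (\<Sum>\<alpha><d. \<Sum>i<N. \<Sum>j<N. cnj (v \<alpha> i) * fcoef (S \<alpha>) (int i - int j) * v \<alpha> j)"
  proof (rule sum.cong[OF refl], rule sum.cong[OF refl])
    fix \<alpha> i assume "\<alpha> \<in> {..<d}"
    have "(\<Sum>\<beta><d. \<Sum>j<N. cnj (v \<alpha> i) * diag_seq S \<alpha> \<beta> (int i - int j) * v \<beta> j)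
       = (\<Sum>\<beta>\<in>{\<alpha>}. \<Sum>j<N. cnj (v \<alpha> i) * diag_seq S \<alpha> \<beta> (int i - int j) * v \<beta> j)"
      by (rule sum.mono_neutral_right) (use \<open>\<alpha> \<in> {..<d}\<close> in \<open>auto simp: diag_seq_def\<close>)
    thus "(\<Sum>\<beta><d. \<Sum>j<N. cnj (v \<alpha> i) * diag_seq S \<alpha> \<beta> (int i - int j) * v \<beta> j)
       = (\<Sum>j<N. cnj (v \<alpha> i) * fcoef (S \<alpha>) (int i - int j) * v \<alpha> j)"
      by (simp add: diag_seq_def)
  qed
  have nonneg: "0 \<le> Re (\<Sum>i<N. \<Sum>j<N. cnj (v \<alpha> i) * fcoef (S \<alpha>) (int i - int j) * v \<alpha> j)"
    (is "0 \<le> Re ?Q") if \<alpha>: "\<alpha> < d" for \<alpha>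
  proof -
    define F where "F x = (\<Sum>j<N. fchar x (- int j) * v \<alpha> j)" for x
    have "((\<lambda>x. \<Sum>i<N. \<Sum>j<N. cnj (v \<alpha> i) * (complex_of_real (S \<alpha> x) * fchar x (int i - int j)) * v \<alpha> j)
       has_integral ?Q) unit_ivl"
      using \<alpha> S
      by (intro has_integral_sum has_integral_mult_left has_integral_mult_right has_integral_fcoef) auto
    also have "(\<lambda>x. \<Sum>i<N. \<Sum>j<N. cnj (v \<alpha> i) * (complex_of_real (S \<alpha> x) * fchar x (int i - int j)) * v \<alpha> j)
       = (\<lambda>x. of_real (S \<alpha> x * (cmod (F x))\<^sup>2))"
    proof
      fix x
      have "of_real (S \<alpha> x * (cmod (F x))\<^sup>2) = of_real (S \<alpha> x) * (cnj (F x) * F x)"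
        unfolding of_real_mult complex_norm_square by (simp add: mult.commute)
      also have "\<dots> = (\<Sum>i<N. \<Sum>j<N. cnj (v \<alpha> i) * (complex_of_real (S \<alpha> x) * fchar x (int i + - int j)) * v \<alpha> j)"
        unfolding fchar_add
        by (simp add: F_def cnj_fchar sum_distrib_left sum_distrib_right mult_ac)
      finally show "(\<Sum>i<N. \<Sum>j<N. cnj (v \<alpha> i) * (complex_of_real (S \<alpha> x) * fchar x (int i - int j)) * v \<alpha> j)
         = of_real (S \<alpha> x * (cmod (F x))\<^sup>2)" by simp
    qed
    finally have "((\<lambda>x. complex_of_real (S \<alpha> x * (cmod (F x))\<^sup>2)) has_integral ?Q) unit_ivl" .
    from has_integral_linear[OF this bounded_linear_Re]
    have "((\<lambda>x. S \<alpha> x * (cmod (F x))\<^sup>2) has_integral Re ?Q) unit_ivl"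
      unfolding o_def Re_complex_of_real .
    thus ?thesis by (rule has_integral_nonneg) (use S(2)[OF \<alpha>] in simp)
  qed
  show "0 \<le> Re (\<Sum>\<alpha><d. \<Sum>i<N. \<Sum>\<beta><d. \<Sum>j<N. cnj (v \<alpha> i) * diag_seq S \<alpha> \<beta> (int i - int j) * v \<beta> j)"
    unfolding eq by (subst Re_sum) (intro sum_nonneg nonneg, simp)
qed

text \<open>The sum \<open>C\<close> of the series is continuous, real and even, and has the same
  coefficients as \<open>S\<close>; the even difference is then killed by
  \<open>even_fourier_unique\<close>. Only almost everywhere equality can be expected, since
  changing \<open>S\<close> on a null set leaves all coefficients alone.\<close>

lemma fourier_inversion_even:
  assumes int: "S integrable_on unit_ivl" and nonneg: "\<And>x. x \<in> unit_ivl \<Longrightarrow> S x \<ge> 0"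
    and even: "\<And>x. x \<in> unit_ivl \<Longrightarrow> S (- x) = S x"
    and sum: "fcoef S abs_summable_on UNIV"
  shows "negligible {x \<in> unit_ivl. (\<Sum>\<^sub>\<infinity>n. fcoef S n * fchar x n) \<noteq> of_real (S x)}"
proof -
  define C where "C x = (\<Sum>\<^sub>\<infinity>n. fcoef S n * fchar x n)" for x
  have coef_even: "fcoef S (- n) = fcoef S n" for n by (rule fcoef_even) (rule even)
  have refl: "(\<Sum>\<^sub>\<infinity>n. fcoef S n * fchar x (- n)) = C x" for x
  proof -
    have "(\<Sum>\<^sub>\<infinity>n. fcoef S n * fchar x (- n)) = (\<Sum>\<^sub>\<infinity>n. fcoef S (0 - n) * fchar x (0 - n))"
      by (intro infsum_cong) (simp add: coef_even)
    also have "\<dots> = C x" unfolding C_def by (rule infsum_int_shift(2))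
    finally show ?thesis .
  qed
  have "cnj (C x) = C x" for x
  proof -
    have "cnj (C x) = (\<Sum>\<^sub>\<infinity>n. fcoef S n * fchar x (- n))"
      unfolding C_def infsum_cnj[symmetric]
      by (intro infsum_cong) (simp add: cnj_fcoef cnj_fchar coef_even)
    thus ?thesis by (simp only: refl)
  qed
  hence C_real: "C x = of_real (Re (C x))" for x by (simp add: complex_eq_iff)
  have C_even: "C (- x) = C x" for x
    unfolding refl[symmetric, of x] by (simp add: C_def fchar_uminus_arg)
  have C_cont: "continuous_on unit_ivl C"
    unfolding C_def by (rule continuous_on_fourier[OF sum])
  have C_int: "((\<lambda>x. C x * fchar x n) has_integral fcoef S n) unit_ivl" for n
  proof -
    have "C x * fchar x n = (\<Sum>\<^sub>\<infinity>m. fcoef S (m - n) * fchar x m)" for x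
    proof -
      have "C x * fchar x n = (\<Sum>\<^sub>\<infinity>m. fcoef S m * fchar x m * fchar x n)"
        unfolding C_def by (rule infsum_cmult_left'[symmetric])
      also have "\<dots> = (\<Sum>\<^sub>\<infinity>m. fcoef S (m - n) * fchar x (m - n) * fchar x n)"
        by (rule infsum_int_shift(1)[symmetric])
      also have "\<dots> = (\<Sum>\<^sub>\<infinity>m. fcoef S (m - n) * fchar x m)"
        by (intro infsum_cong) (simp add: mult.assoc flip: fchar_add)
      finally show ?thesis .
    qed
    \<comment> \<open>Because \<open>fcoef\<close> and the series share the sign in the exponent,
      integration extracts the coefficient at \<open>- n\<close>; evenness turns it into the one at
      \<open>n\<close>.\<close>
    moreover have "((\<lambda>x. \<Sum>\<^sub>\<infinity>m. fcoef S (m - n) * fchar x m) has_integral fcoef S (0 - n)) unit_ivl"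
      using sum by (intro has_integral_fourier) simp
    ultimately show ?thesis by (simp add: coef_even)
  qed
  define h where "h x = S x - Re (C x)" for x
  have "negligible {x \<in> unit_ivl. h x \<noteq> 0}"
  proof (rule even_fourier_unique)
    have "S absolutely_integrable_on unit_ivl"
      using int nonneg by (intro nonnegative_absolutely_integrable_1)
    moreover have "(\<lambda>x. Re (C x)) absolutely_integrable_on unit_ivl"
      by (intro absolutely_integrable_continuous_real continuous_intros C_cont)
    ultimately show "h absolutely_integrable_on unit_ivl"
      unfolding h_def by (rule set_integral_diff(1))
    show "h (- x) = h x" if "x \<in> unit_ivl" for x
      using even[OF that] by (simp add: h_def C_even)
    show "((\<lambda>x. complex_of_real (h x) * fchar x n) has_integral 0) unit_ivl" for n
    proof -
      have "((\<lambda>x. complex_of_real (S x) * fchar x n - C x * fchar x n) has_integral fcoef S n - fcoef S n) unit_ivl"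
        by (intro has_integral_diff has_integral_fcoef C_int int nonneg)
      also have "(\<lambda>x. complex_of_real (S x) * fchar x n - C x * fchar x n)
          = (\<lambda>x. complex_of_real (h x) * fchar x n)"
      proof
        fix x
        have "complex_of_real (h x) = complex_of_real (S x) - C x"
          unfolding h_def of_real_diff C_real[of x, symmetric] ..
        thus "complex_of_real (S x) * fchar x n - C x * fchar x n = complex_of_real (h x) * fchar x n"
          by (simp add: left_diff_distrib)
      qed
      finally show ?thesis by simp
    qed
  qed
  moreover have "{x \<in> unit_ivl. C x \<noteq> of_real (S x)} \<subseteq> {x \<in> unit_ivl. h x \<noteq> 0}"
  proof clarify
    fix x assume "C x \<noteq> of_real (S x)" "h x = 0"
    thus False using C_real[of x] by (simp add: h_def)
  qed
  ultimately show ?thesis unfolding C_def by (rule negligible_subset)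
qed

subsection \<open>The rates\<close>

lemma det_2:
  fixes A :: "'a :: comm_ring_1 mat"
  assumes A: "A \<in> carrier_mat 2 2"
  shows "det A = A $$ (0, 0) * A $$ (1, 1) - A $$ (0, 1) * A $$ (1, 0)"
proof -
  have d: "det (mat_delete A 0 j) = mat_delete A 0 j $$ (0, 0)" for j
    using mat_delete_carrier[OF A, of 0 j] by (intro det_single) simp
  have c: "cofactor A 0 0 = A $$ (1, 1)" "cofactor A 0 1 = - A $$ (1, 0)"
    unfolding cofactor_def d using A by (simp_all add: mat_delete_def)
  have "det A = (\<Sum>j<2. A $$ (0, j) * cofactor A 0 j)"
    by (rule laplace_expansion_row[OF A]) simp
  also have "\<dots> = A $$ (0, 0) * A $$ (1, 1) - A $$ (0, 1) * A $$ (1, 0)"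
    using c by (simp add: numeral_2_eq_2)
  finally show ?thesis .
qed

lemma bsummable_pulse_seq:
  assumes "\<And>s. (\<lambda>n::int. norm (autocorr p (real_of_int n * D + s))) summable_on UNIV"
  shows "bsummable d (pulse_seq p c D \<tau>)"
  unfolding bsummable_def pulse_seq_def
  using assms by (auto simp: norm_mult intro!: summable_on_cmult_right)

lemma bsummable_diag_seq:
  assumes "\<And>\<alpha>. \<alpha> < d \<Longrightarrow> fcoef (S \<alpha>) abs_summable_on UNIV"
  shows "bsummable d (diag_seq S)"
  unfolding bsummable_def
proof (intro allI impI)
  fix \<alpha> \<beta> assume "\<alpha> < d" "\<beta> < d"
  thus "diag_seq S \<alpha> \<beta> abs_summable_on UNIV"
    using assms[of \<alpha>] by (cases "\<alpha> = \<beta>") (simp_all add: diag_seq_def)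
qed

lemma bsymb_pulse_seq:
  assumes "\<alpha> < d" "\<beta> < d"
  shows "bsymb d (pulse_seq p c (\<delta> * T) \<tau>) x $$ (\<alpha>, \<beta>) = of_real c * folded_spec (autocorr p) \<delta> T (\<tau> \<alpha> - \<tau> \<beta>) x"
  using assms
  by (simp add: bsymb_def pulse_seq_def folded_spec_def fchar_def mult.assoc infsum_cmult_right')

lemma bsymb_diag_seq:
  assumes "\<alpha> < d" "\<beta> < d"
  shows "bsymb d (diag_seq S) x $$ (\<alpha>, \<beta>) = (if \<alpha> = \<beta> then \<Sum>\<^sub>\<infinity>n. fcoef (S \<alpha>) n * fchar x n else 0)"
  using assms by (simp add: bsymb_def diag_seq_def)

lemma one_plus_bsymb_mult_carrier:
  "1\<^sub>m d + bsymb d a x * bsymb d b x \<in> carrier_mat d d"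
  by (intro add_carrier_mat mult_carrier_mat[where n = d]) simp_all

text \<open>\<open>f\<close> stays abstract so that one argument serves both rate integrands. It has
  to match the symbol determinant only where every Fourier series reproduces its spectrum, which
  holds almost everywhere and leaves the integral unaffected. The factor
  \<open>1 / (2 * ln 2)\<close> below combines the one half of the rate with the change to base
  2.\<close>

lemma logdet_rate_limit:
  assumes p: "p measurable_on UNIV" "(\<lambda>s. (cmod (p s))\<^sup>2) integrable_on UNIV"
    and sum: "\<And>s. (\<lambda>n::int. norm (autocorr p (real_of_int n * D + s))) summable_on UNIV"
    and \<sigma>2: "\<sigma>2 > 0"
    and S: "\<And>\<alpha>. \<alpha> < d \<Longrightarrow> S \<alpha> integrable_on unit_ivl"
      "\<And>\<alpha> x. \<alpha> < d \<Longrightarrow> x \<in> unit_ivl \<Longrightarrow> S \<alpha> x \<ge> 0"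
      "\<And>\<alpha> x. \<alpha> < d \<Longrightarrow> x \<in> unit_ivl \<Longrightarrow> S \<alpha> (- x) = S \<alpha> x"
      "\<And>\<alpha>. \<alpha> < d \<Longrightarrow> fcoef (S \<alpha>) abs_summable_on UNIV"
    and G: "\<And>N. G N = btoep d N (pulse_seq p 1 D \<tau>)"
    and R: "\<And>N. R N = btoep d N (diag_seq S)"
    and f: "\<And>x. (\<And>\<alpha>. \<alpha> < d \<Longrightarrow> (\<Sum>\<^sub>\<infinity>n. fcoef (S \<alpha>) n * fchar x n) = of_real (S \<alpha> x)) \<Longrightarrow>
      f x = Re (det (1\<^sub>m d + bsymb d (pulse_seq p (1 / \<sigma>2) D \<tau>) x * bsymb d (diag_seq S) x))"
  shows "(\<lambda>N. logdet_rate \<sigma>2 N (G N) (R N)) \<longlonglongrightarrow> 1/2 * integral unit_ivl (\<lambda>x. log 2 (f x))"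
proof -
  let ?a = "pulse_seq p (1 / \<sigma>2) D \<tau>" and ?b = "diag_seq S"
  let ?M = "\<lambda>N. 1\<^sub>m (d * N) + btoep d N ?a * btoep d N ?b"
  let ?l = "\<lambda>x. ln (Re (det (1\<^sub>m d + bsymb d ?a x * bsymb d ?b x)))"
  \<comment> \<open>The noise factor moves onto the pulse matrix, so the expression becomes the
    identity plus a product of two positive semidefinite sections.\<close>
  have GR: "1\<^sub>m (dim_row (G N)) + complex_of_real (1 / \<sigma>2) \<cdot>\<^sub>m (G N * R N) = ?M N" for N
  proof -
    have "complex_of_real (1 / \<sigma>2) \<cdot>\<^sub>m G N = btoep d N ?a"
      by (rule eq_matI) (auto simp: G btoep_def pulse_seq_def)
    moreover have "complex_of_real (1 / \<sigma>2) \<cdot>\<^sub>m (G N * R N) = (complex_of_real (1 / \<sigma>2) \<cdot>\<^sub>m G N) * R N"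
      by (rule mult_smult_assoc_mat[symmetric, of _ "d * N" "d * N" _ "d * N"]) (simp_all add: G R)
    moreover have "dim_row (G N) = d * N" by (simp add: G btoep_def)
    ultimately show ?thesis by (simp add: R)
  qed
  have "(\<lambda>N. ln (Re (det (?M N))) / real N) \<longlonglongrightarrow> integral unit_ivl ?l"
    using \<sigma>2
    by (intro szego_psd_product bsummable_pulse_seq bpsd_pulse_seq bsummable_diag_seq bpsd_diag_seq p sum S) auto
  hence "(\<lambda>N. 1 / (2 * ln 2) * (ln (Re (det (?M N))) / real N)) \<longlonglongrightarrow> 1 / (2 * ln 2) * integral unit_ivl ?l"
    by (intro tendsto_intros)
  moreover have "1 / (2 * ln 2) * (ln (Re (det (?M N))) / real N) = logdet_rate \<sigma>2 N (G N) (R N)" for N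
    unfolding logdet_rate_def GR by (simp add: log_def)
  moreover have "1 / (2 * ln 2) * integral unit_ivl ?l = 1/2 * integral unit_ivl (\<lambda>x. log 2 (f x))"
  proof -
    \<comment> \<open>The exceptional frequencies of all users; a finite union of null sets.\<close>
    define B where "B = (\<Union>\<alpha><d. {x \<in> unit_ivl. (\<Sum>\<^sub>\<infinity>n. fcoef (S \<alpha>) n * fchar x n) \<noteq> of_real (S \<alpha> x)})"
    have "negligible {x \<in> unit_ivl. (\<Sum>\<^sub>\<infinity>n. fcoef (S \<alpha>) n * fchar x n) \<noteq> of_real (S \<alpha> x)}"
      if "\<alpha> < d" for \<alpha>
      by (rule fourier_inversion_even) (use that S in blast)+
    hence "negligible B" unfolding B_def by (intro negligible_Union) blast+
    moreover have "log 2 (f x) = ?l x / ln 2" if "x \<in> unit_ivl - B" for x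
    proof -
      have "f x = Re (det (1\<^sub>m d + bsymb d ?a x * bsymb d ?b x))"
        by (rule f) (use that in \<open>auto simp: B_def\<close>)
      thus ?thesis by (simp add: log_def)
    qed
    ultimately have "integral unit_ivl (\<lambda>x. ?l x / ln 2) = integral unit_ivl (\<lambda>x. log 2 (f x))"
      by (rule integral_spike)
    thus ?thesis by simp
  qed
  ultimately show ?thesis by (simp only:)
qed

section \<open>The channel and data matrices as block Toeplitz sections\<close>

lemma Rmat_btoep: "Rmat S N = btoep 1 N (diag_seq (\<lambda>_. S))"
  by (rule eq_matI) (auto simp: Rmat_def btoep_def diag_seq_def)

lemma Gmat_btoep: "Gmat (autocorr p) \<delta> T 0 N = btoep 1 N (pulse_seq p 1 (\<delta> * T) (\<lambda>_. 0))"
  by (rule eq_matI) (auto simp: Gmat_def btoep_def pulse_seq_def mult.assoc)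

lemma div_mod_second_block:
  fixes i N :: nat
  assumes "\<not> i < N" "i < 2 * N"
  shows "i div N = 1" "i mod N = i - N"
  using assms by (auto simp: div_nat_eqI le_mod_geq)

lemma Rtilde_btoep: "Rtilde S1 S2 N = btoep 2 N (diag_seq (\<lambda>\<alpha>. if \<alpha> = 0 then S1 else S2))"
proof (rule eq_matI)
  fix i j assume "i < dim_row (btoep 2 N (diag_seq (\<lambda>\<alpha>. if \<alpha> = 0 then S1 else S2)))"
    "j < dim_col (btoep 2 N (diag_seq (\<lambda>\<alpha>. if \<alpha> = 0 then S1 else S2)))"
  hence "i < 2 * N" "j < 2 * N" by (simp_all add: btoep_def)
  thus "Rtilde S1 S2 N $$ (i, j) = btoep 2 N (diag_seq (\<lambda>\<alpha>. if \<alpha> = 0 then S1 else S2)) $$ (i, j)"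
    by (cases "i < N"; cases "j < N")
       (simp_all add: Rtilde_def Rmat_def btoep_index diag_seq_def div_mod_second_block)
qed (auto simp: Rtilde_def Rmat_def btoep_def)

text \<open>The lower left block is defined as an adjoint; Hermitian symmetry of the autocorrelation
  turns its entries into autocorrelation samples with the delay difference reversed, as
  \<open>pulse_seq\<close> prescribes.\<close>

lemma Gtilde_btoep:
  assumes p: "p measurable_on UNIV" "(\<lambda>s. (cmod (p s))\<^sup>2) integrable_on UNIV"
  shows "Gtilde (autocorr p) \<delta> T \<tau>1 \<tau>2 N
    = btoep 2 N (pulse_seq p 1 (\<delta> * T) (\<lambda>\<alpha>. if \<alpha> = 0 then \<tau>1 else \<tau>2))"
proof (rule eq_matI)
  fix i j assume "i < dim_row (btoep 2 N (pulse_seq p 1 (\<delta> * T) (\<lambda>\<alpha>. if \<alpha> = 0 then \<tau>1 else \<tau>2)))"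
    "j < dim_col (btoep 2 N (pulse_seq p 1 (\<delta> * T) (\<lambda>\<alpha>. if \<alpha> = 0 then \<tau>1 else \<tau>2)))"
  hence ij: "i < 2 * N" "j < 2 * N" by (simp_all add: btoep_def)
  have adj: "mat_adjoint (Gmat (autocorr p) \<delta> T s N) $$ (k, l)
      = autocorr p ((real k - real l) * (\<delta> * T) - s)" if "k < N" "l < N" for k l s
  proof -
    have "mat_adjoint (Gmat (autocorr p) \<delta> T s N) $$ (k, l) = cnj (autocorr p ((real l - real k) * \<delta> * T + s))"
      using that by (simp add: mat_adjoint_def Gmat_def mat_of_rows_def)
    also have "\<dots> = autocorr p (- ((real l - real k) * \<delta> * T + s))"
      by (rule autocorr_uminus[OF p, symmetric])
    finally show ?thesis by (simp add: algebra_simps)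
  qed
  have Gm: "Gmat (autocorr p) \<delta> T s N $$ (k, l) = autocorr p ((real k - real l) * (\<delta> * T) + s)"
    if "k < N" "l < N" for k l s
    using that by (simp add: Gmat_def mult.assoc)
  have Gm_dim: "dim_row (Gmat (autocorr p) \<delta> T s N) = N" "dim_col (Gmat (autocorr p) \<delta> T s N) = N" for s
    by (simp_all add: Gmat_def)
  have adj_dim: "dim_row (mat_adjoint (Gmat (autocorr p) \<delta> T s N)) = N"
    "dim_col (mat_adjoint (Gmat (autocorr p) \<delta> T s N)) = N" for s
    by (simp_all add: mat_adjoint_def Gmat_def)
  have flip: "r - (\<tau>1 - \<tau>2) = r + (\<tau>2 - \<tau>1)" for r :: real by simp
  show "Gtilde (autocorr p) \<delta> T \<tau>1 \<tau>2 N $$ (i, j)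
    = btoep 2 N (pulse_seq p 1 (\<delta> * T) (\<lambda>\<alpha>. if \<alpha> = 0 then \<tau>1 else \<tau>2)) $$ (i, j)"
    using ij
    by (cases "i < N"; cases "j < N")
       (simp_all add: Gtilde_def Gm Gm_dim adj adj_dim btoep_index pulse_seq_def div_mod_second_block flip)
qed (auto simp: Gtilde_def Gmat_def btoep_def)

lemma int_rate1_limit:
  assumes p: "p measurable_on UNIV" "(\<lambda>s. (cmod (p s))\<^sup>2) integrable_on UNIV"
    and sum: "\<And>s. (\<lambda>n::int. norm (autocorr p (real_of_int n * \<delta> * T + s))) summable_on UNIV"
    and \<sigma>2: "\<sigma>2 > 0" and S: "admissible (autocorr p) \<delta> T P S"
  shows "(\<lambda>N. logdet_rate \<sigma>2 N (Gmat (autocorr p) \<delta> T 0 N) (Rmat S N)) \<longlonglongrightarrow> int_rate1 (autocorr p) \<delta> T \<sigma>2 S"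
  unfolding int_rate1_def
proof (rule logdet_rate_limit[OF p _ \<sigma>2 _ _ _ _ Gmat_btoep Rmat_btoep])
  fix x assume "\<And>\<alpha>::nat. \<alpha> < 1 \<Longrightarrow> (\<Sum>\<^sub>\<infinity>n. fcoef S n * fchar x n) = of_real (S x)"
  hence C: "(\<Sum>\<^sub>\<infinity>n. fcoef S n * fchar x n) = of_real (S x)" by simp
  let ?A = "bsymb 1 (pulse_seq p (1 / \<sigma>2) (\<delta> * T) (\<lambda>_. 0)) x" and ?B = "bsymb 1 (diag_seq (\<lambda>_. S)) x"
  have "det (1\<^sub>m 1 + ?A * ?B) = (1\<^sub>m 1 + ?A * ?B) $$ (0, 0)"
    by (rule det_single) (rule one_plus_bsymb_mult_carrier)
  also have "\<dots> = 1 + (?A * ?B) $$ (0, 0)"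
    by (simp add: bsymb_def)
  also have "(?A * ?B) $$ (0, 0) = ?A $$ (0, 0) * ?B $$ (0, 0)"
    by (subst index_mult_mat_lessThan[of _ 1 1 _ 1]) auto
  finally show "1 + Re (folded_spec (autocorr p) \<delta> T 0 x) * S x / \<sigma>2 = Re (det (1\<^sub>m 1 + ?A * ?B))"
    by (simp add: bsymb_pulse_seq bsymb_diag_seq C)
qed (use S sum in \<open>auto simp: admissible_def mult.assoc\<close>)

text \<open>At each frequency the determinant is 2 by 2: the product of the two single-user factors
  minus a cross term with the squared modulus of \<open>H\<close>. Since the symbol is Hermitian,
  \<open>G\<close> is real, and writing the cross term through \<open>H / G\<close> gives the
  bracket of the integrand.\<close>

lemma int_rate_sum_limit:
  assumes p: "p measurable_on UNIV" "(\<lambda>s. (cmod (p s))\<^sup>2) integrable_on UNIV"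
    and sum: "\<And>s. (\<lambda>n::int. norm (autocorr p (real_of_int n * \<delta> * T + s))) summable_on UNIV"
    and \<sigma>2: "\<sigma>2 > 0"
    and S: "admissible (autocorr p) \<delta> T P1 S1" "admissible (autocorr p) \<delta> T P2 S2"
  shows "(\<lambda>N. logdet_rate \<sigma>2 N (Gtilde (autocorr p) \<delta> T \<tau>1 \<tau>2 N) (Rtilde S1 S2 N))
    \<longlonglongrightarrow> int_rate_sum (autocorr p) \<delta> T \<tau>1 \<tau>2 \<sigma>2 S1 S2"
  unfolding int_rate_sum_def Let_def
proof (rule logdet_rate_limit[OF p _ \<sigma>2 _ _ _ _ Gtilde_btoep[OF p] Rtilde_btoep])
  define S where "S \<alpha> = (if \<alpha> = 0 then S1 else S2)" for \<alpha> :: nat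
  define \<tau> where "\<tau> \<alpha> = (if \<alpha> = 0 then \<tau>1 else \<tau>2)" for \<alpha> :: nat
  fix x
  assume "\<And>\<alpha>::nat. \<alpha> < 2 \<Longrightarrow> (\<Sum>\<^sub>\<infinity>n. fcoef (if \<alpha> = 0 then S1 else S2) n * fchar x n)
     = of_real ((if \<alpha> = 0 then S1 else S2) x)"
  from this[of 0] this[of 1] have C: "(\<Sum>\<^sub>\<infinity>n. fcoef S1 n * fchar x n) = of_real (S1 x)"
      "(\<Sum>\<^sub>\<infinity>n. fcoef S2 n * fchar x n) = of_real (S2 x)" by simp_all
  let ?A = "bsymb 2 (pulse_seq p (1 / \<sigma>2) (\<delta> * T) \<tau>) x" and ?B = "bsymb 2 (diag_seq S) x"
  define G where "G = folded_spec (autocorr p) \<delta> T 0 x"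
  define H where "H = folded_spec (autocorr p) \<delta> T (\<tau>1 - \<tau>2) x"
  have sum': "(\<lambda>n::int. norm (autocorr p (real_of_int n * (\<delta> * T) + s))) summable_on UNIV" for s
    using sum by (simp add: mult.assoc)
  have psd: "psd 2 ?A"
    using \<sigma>2 by (intro psd_bsymb bsummable_pulse_seq bpsd_pulse_seq p sum') auto
  have A: "?A $$ (0, 0) = of_real (1 / \<sigma>2) * G" "?A $$ (1, 1) = of_real (1 / \<sigma>2) * G"
    "?A $$ (0, 1) = of_real (1 / \<sigma>2) * H"
    by (simp_all add: bsymb_pulse_seq G_def H_def \<tau>_def)
  have herm: "?A $$ (j, i) = cnj (?A $$ (i, j))" if "i < 2" "j < 2" for i j
    using psd that unfolding psd_def by blast
  have A10: "?A $$ (1, 0) = of_real (1 / \<sigma>2) * cnj H"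
    using herm[of 0 1] A(3) by simp
  have "of_real (1 / \<sigma>2) * G = cnj (of_real (1 / \<sigma>2) * G)"
    using herm[of 0 0] unfolding A(1) by simp
  hence "G = cnj G" using \<sigma>2 by simp
  hence G: "G = of_real (Re G)" by (simp add: complex_eq_iff)
  \<comment> \<open>A zero diagonal entry makes the first unit vector \<open>e\<close> a zero of the
    form, so \<open>psd_kernel\<close> annihilates the whole first column, including
    \<open>cnj H / \<sigma>2\<close>.\<close>
  have HG: "H = 0" if "Re G = 0"
  proof -
    have "G = 0" using G that by simp
    define e :: "nat \<Rightarrow> complex" where "e i = (if i = 0 then 1 else 0)" for i
    have "sesq 2 ?A e e = 0"
      using A(1) \<open>G = 0\<close> by (simp add: sesq_def e_def numeral_2_eq_2)
    from psd_kernel[OF psd this, of 1] have "?A $$ (1, 0) = 0"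
      by (simp add: e_def numeral_2_eq_2)
    thus ?thesis using A10 \<sigma>2 by simp
  qed
  have AB: "(1\<^sub>m 2 + ?A * ?B) $$ (i, j) = (if i = j then 1 else 0) + ?A $$ (i, j) * of_real (S j x)"
    if "i < 2" "j < 2" for i j
  proof -
    have "(?A * ?B) $$ (i, j) = (\<Sum>l<2. ?A $$ (i, l) * ?B $$ (l, j))"
      by (rule index_mult_mat_lessThan) (use that in auto)
    also have "\<dots> = (\<Sum>l\<in>{j}. ?A $$ (i, l) * ?B $$ (l, j))"
      by (rule sum.mono_neutral_right) (use that in \<open>auto simp: bsymb_diag_seq\<close>)
    also have "\<dots> = ?A $$ (i, j) * of_real (S j x)"
      using that C by (auto simp: bsymb_diag_seq S_def)
    finally show ?thesis using that by (simp add: bsymb_def)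
  qed
  have "det (1\<^sub>m 2 + ?A * ?B)
     = (1 + of_real (1 / \<sigma>2) * G * of_real (S1 x)) * (1 + of_real (1 / \<sigma>2) * G * of_real (S2 x))
       - of_real (1 / \<sigma>2) * H * of_real (S2 x) * (of_real (1 / \<sigma>2) * cnj H * of_real (S1 x))"
  proof -
    have "(1\<^sub>m 2 + ?A * ?B) $$ (0, 0) = 1 + ?A $$ (0, 0) * of_real (S1 x)"
      "(1\<^sub>m 2 + ?A * ?B) $$ (0, 1) = ?A $$ (0, 1) * of_real (S2 x)"
      "(1\<^sub>m 2 + ?A * ?B) $$ (1, 0) = ?A $$ (1, 0) * of_real (S1 x)"
      "(1\<^sub>m 2 + ?A * ?B) $$ (1, 1) = 1 + ?A $$ (1, 1) * of_real (S2 x)"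
      using AB[of 0 0] AB[of 0 1] AB[of 1 0] AB[of 1 1] by (simp_all add: S_def)
    thus ?thesis
      unfolding det_2[OF one_plus_bsymb_mult_carrier] by (simp only: A A10)
  qed
  also have "\<dots> = (1 + of_real (1 / \<sigma>2) * of_real (Re G) * of_real (S1 x))
         * (1 + of_real (1 / \<sigma>2) * of_real (Re G) * of_real (S2 x))
       - of_real (1 / \<sigma>2) * of_real (1 / \<sigma>2) * of_real (S1 x) * of_real (S2 x) * (H * cnj H)"
    unfolding G[symmetric] by (simp add: mult_ac)
  also have "\<dots> = of_real ((1 + 1 / \<sigma>2 * Re G * S1 x) * (1 + 1 / \<sigma>2 * Re G * S2 x)
       - 1 / \<sigma>2 * (1 / \<sigma>2) * S1 x * S2 x * (cmod H)\<^sup>2)"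
    unfolding complex_norm_square[symmetric] by simp
  finally have det: "Re (det (1\<^sub>m 2 + ?A * ?B)) = (1 + 1 / \<sigma>2 * Re G * S1 x) * (1 + 1 / \<sigma>2 * Re G * S2 x)
       - 1 / \<sigma>2 * (1 / \<sigma>2) * S1 x * S2 x * (cmod H)\<^sup>2"
    by (simp only: Re_complex_of_real)
  have "1 + Re G * S1 x / \<sigma>2 + Re G * S2 x / \<sigma>2
      + Re G * S1 x * (Re G * S2 x) / \<sigma>2\<^sup>2 * (1 - (cmod (H / G))\<^sup>2)
    = (1 + 1 / \<sigma>2 * Re G * S1 x) * (1 + 1 / \<sigma>2 * Re G * S2 x)
       - 1 / \<sigma>2 * (1 / \<sigma>2) * S1 x * S2 x * (cmod H)\<^sup>2"
  proof (cases "Re G = 0")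
    case True
    thus ?thesis using HG by simp
  next
    case False
    have "cmod G = \<bar>Re G\<bar>" by (subst G) (rule norm_of_real)
    hence "(cmod (H / G))\<^sup>2 = (cmod H)\<^sup>2 / (Re G)\<^sup>2"
      by (simp add: norm_divide power_divide)
    thus ?thesis using False \<sigma>2 by (simp add: field_simps power2_eq_square)
  qed
  thus "1 + Re (folded_spec (autocorr p) \<delta> T 0 x) * S1 x / \<sigma>2 + Re (folded_spec (autocorr p) \<delta> T 0 x) * S2 x / \<sigma>2
      + Re (folded_spec (autocorr p) \<delta> T 0 x) * S1 x * (Re (folded_spec (autocorr p) \<delta> T 0 x) * S2 x) / \<sigma>2\<^sup>2
        * (1 - (cmod (folded_spec (autocorr p) \<delta> T (\<tau>1 - \<tau>2) x / folded_spec (autocorr p) \<delta> T 0 x))\<^sup>2)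
    = Re (det (1\<^sub>m 2 + bsymb 2 (pulse_seq p (1 / \<sigma>2) (\<delta> * T) (\<lambda>\<alpha>. if \<alpha> = 0 then \<tau>1 else \<tau>2)) x
        * bsymb 2 (diag_seq (\<lambda>\<alpha>. if \<alpha> = 0 then S1 else S2)) x))"
    using det unfolding G_def H_def S_def[abs_def] \<tau>_def[abs_def] by (simp only:)
qed (use S sum in \<open>auto simp: admissible_def mult.assoc\<close>)

theorem theorem1:
  fixes p :: "real \<Rightarrow> complex" and T \<delta> \<tau>1 \<tau>2 \<sigma>2 P1 P2 :: real
  assumes "T > 0" and "0 < \<delta>" and "\<delta> \<le> 1"
    and "0 \<le> \<tau>1" and "\<tau>1 \<le> \<tau>2" and "\<tau>2 \<le> T"
    and "\<sigma>2 > 0" and "P1 > 0" and "P2 > 0"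
    and "p measurable_on UNIV" and "(\<lambda>s. (cmod (p s))\<^sup>2) integrable_on UNIV"
    and "\<And>s. (\<lambda>n::int. norm (autocorr p (real_of_int n * \<delta> * T + s))) summable_on UNIV"
  shows "(\<forall>Sa1 Sa2. admissible (autocorr p) \<delta> T P1 Sa1 \<and> admissible (autocorr p) \<delta> T P2 Sa2 \<longrightarrow>
            (\<lambda>N. logdet_rate \<sigma>2 N (Gmat (autocorr p) \<delta> T 0 N) (Rmat Sa1 N))
               \<longlonglongrightarrow> int_rate1 (autocorr p) \<delta> T \<sigma>2 Sa1 \<and>
            (\<lambda>N. logdet_rate \<sigma>2 N (Gmat (autocorr p) \<delta> T 0 N) (Rmat Sa2 N))
               \<longlonglongrightarrow> int_rate1 (autocorr p) \<delta> T \<sigma>2 Sa2 \<and>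
            (\<lambda>N. logdet_rate \<sigma>2 N (Gtilde (autocorr p) \<delta> T \<tau>1 \<tau>2 N) (Rtilde Sa1 Sa2 N))
               \<longlonglongrightarrow> int_rate_sum (autocorr p) \<delta> T \<tau>1 \<tau>2 \<sigma>2 Sa1 Sa2)
         \<and> cap_region_lim (autocorr p) \<delta> T \<tau>1 \<tau>2 \<sigma>2 P1 P2
           = cap_region_int (autocorr p) \<delta> T \<tau>1 \<tau>2 \<sigma>2 P1 P2"
proof -
  note hyps = assms(10,11,12,7)
  note lim1 = int_rate1_limit[OF hyps]
  note lim_sum = int_rate_sum_limit[OF hyps]
  have "cap_region_lim (autocorr p) \<delta> T \<tau>1 \<tau>2 \<sigma>2 P1 P2
      = cap_region_int (autocorr p) \<delta> T \<tau>1 \<tau>2 \<sigma>2 P1 P2"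
  proof (rule Set.set_eqI)
    fix z :: "real \<times> real"
    obtain R1 R2 where z: "z = (R1, R2)" by (cases z)
    show "z \<in> cap_region_lim (autocorr p) \<delta> T \<tau>1 \<tau>2 \<sigma>2 P1 P2
        \<longleftrightarrow> z \<in> cap_region_int (autocorr p) \<delta> T \<tau>1 \<tau>2 \<sigma>2 P1 P2"
      unfolding cap_region_lim_def cap_region_int_def z mem_Collect_eq prod.case
      apply (rule ex_cong1, rule ex_cong1)
      subgoal for Sa1 Sa2
        \<comment> \<open>For an admissible pair the three values of \<open>lim\<close> are the
          integrals, so the regions agree pair by pair and not merely as unions; for any other pair
          both conditions are false.\<close>
        using limI[OF lim1, of P1 Sa1] limI[OF lim1, of P2 Sa2] limI[OF lim_sum, of P1 Sa1 P2 Sa2]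
        by (cases "admissible (autocorr p) \<delta> T P1 Sa1"; cases "admissible (autocorr p) \<delta> T P2 Sa2") auto
      done
  qed
  thus ?thesis using lim1 lim_sum by blast
qed

end
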